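(* Let $n$ be a positive integer. The limit wave speed $c_0(h)$ of periodic traveling waves of the perturbed generalized KdV equation $$U_t+U^nU_x+U_{xxx}+\epsilon\,(U_{xx}+U_{xxxx})=0$$ is monotonically increasing on $\left(-\frac{n(n+1)^{2/n}}{2(n+2)},\,0\right)$.
   Context: Traveling waves are $U(x,t)=U(\xi)$, $\xi=x-ct$, $c>0$, with zero integration constant after one integration. With $U=\sqrt[n]{c}\,u$, $\xi=\eta/\sqrt c$, and reduction to a slow manifold by geometric singular perturbation theory (omitting $O(\epsilon^2)$ terms), the traveling wave equation becomes $$\frac{du}{d\eta}=y,\qquad \frac{dy}{d\eta}=u-\frac{1}{n+1}u^{n+1}+\epsilon\sqrt c\left(u^ny-\left(1+\frac1c\right)y\right).$$ For $\epsilon=0$ this is Hamiltonian with $H(u,y)=\frac{y^2}{2}-\frac{u^2}{2}+\frac{u^{n+2}}{(n+1)(n+2)}$. For $h\in\left(-\frac{n(n+1)^{2/n}}{2(n+2)},0\right)$, $\Gamma_h$ denotes the closed orbit $H(u,y)=h$ surrounding the center $(\sqrt[n]{n+1},0)$ in $u>0$, oriented by the flow. It is known (Yan et al., 2014) that for all sufficiently small $\epsilon>0$ and $h\in\left(-\frac{n(n+1)^{2/n}}{2(n+2)},0\right)$ there is a periodic traveling wave, bifurcating from $\Gamma_h$, whose wave speed $c=c(\epsilon,h)$ is a smooth function of $\epsilon$ and $h$ and converges, as $\epsilon\to0$, to a smooth function $c_0(h)$. The function $c_0(h)$ is called the limit wave speed. It is the value $c=c_0(h)>0$ at which the Abelian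 integral $$A(h)=\oint_{\Gamma_h}\sqrt c\left(u^ny-\left(1+\frac1c\right)y\right)du$$ vanishes, i.e. it is determined by $$\frac{\oint_{\Gamma_h}u^ny\,du}{\oint_{\Gamma_h}y\,du}=1+\frac{1}{c_0(h)}.$$ *)

theory Defs
  imports "HOL-Analysis.Analysis"
begin

definition hamiltonian :: "nat \<Rightarrow> real \<Rightarrow> real \<Rightarrow> real" where
  "hamiltonian n u y = y\<^sup>2 / 2 - u\<^sup>2 / 2 + u ^ (n + 2) / ((real n + 1) * (real n + 2))"

text \<open>
  A travelling wave \<open>U (x - c * t)\<close> of
  \<open>U\<^sub>t + U\<^sup>n U\<^sub>x + U\<^sub>x\<^sub>x\<^sub>x + \<epsilon> (U\<^sub>x\<^sub>x + U\<^sub>x\<^sub>x\<^sub>x\<^sub>x) = 0\<close>, integrated once with zero constant,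
  rescaled by \<open>U = root n c * u\<close>, \<open>x - c * t = \<eta> / sqrt c\<close> and reduced to the slow manifold
  up to terms of second order in \<open>\<epsilon>\<close>, satisfies
  \<open>u' = y\<close> and \<open>y' = force n u + \<epsilon> * perturbation n c u y\<close>.
\<close>

definition force :: "nat \<Rightarrow> real \<Rightarrow> real" where
  "force n u = u - u ^ (n + 1) / (real n + 1)"

definition perturbation :: "nat \<Rightarrow> real \<Rightarrow> real \<Rightarrow> real \<Rightarrow> real" where
  "perturbation n c u y = sqrt c * (u ^ n * y - (1 + 1 / c) * y)"

text \<open>
  The energies strictly between that of the centre \<open>(root n (n + 1), 0)\<close> and that of the
  homoclinic loop.
\<close>

definition energy_range :: "nat \<Rightarrow> real set" where
  "energy_range n =
     {- (real n * (real n + 1) powr (2 / real n)) / (2 * (real n + 2)) <..< 0}"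

text \<open>
  For \<open>h\<close> in \<open>energy_range n\<close> the part of the level set in the half plane \<open>u > 0\<close> is exactly
  the oval \<open>\<Gamma>\<^sub>h\<close> around the centre: since \<open>h < 0\<close>, the level set does not meet \<open>u = 0\<close>.
\<close>

definition oval :: "nat \<Rightarrow> real \<Rightarrow> (real \<times> real) set" where
  "oval n h = {(u, y). 0 < u \<and> hamiltonian n u y = h}"

text \<open>
  \<open>(u, y)\<close> is a solution of the unperturbed system that runs through \<open>\<Gamma>\<^sub>h\<close> exactly once
  during \<open>[0, T]\<close>.  Parametrising by a solution fixes the orientation by the flow.
\<close>

definition traverses_oval ::
  "nat \<Rightarrow> real \<Rightarrow> real \<Rightarrow> (real \<Rightarrow> real) \<Rightarrow> (real \<Rightarrow> real) \<Rightarrow> bool" where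
  "traverses_oval n h T u y \<longleftrightarrow>
     0 < T \<and>
     (\<forall>t. (u has_real_derivative y t) (at t)) \<and>
     (\<forall>t. (y has_real_derivative force n (u t)) (at t)) \<and>
     (u T, y T) = (u 0, y 0) \<and>
     inj_on (\<lambda>t. (u t, y t)) {0..<T} \<and>
     (\<lambda>t. (u t, y t)) ` {0..T} = oval n h"

text \<open>
  The line integral of the one-form \<open>P(u, y) du\<close> along \<open>\<Gamma>\<^sub>h\<close>.  Two traversals of
  \<open>\<Gamma>\<^sub>h\<close> by the flow differ only by a time shift, so the value does not depend on the choice.
\<close>

definition oval_integral :: "nat \<Rightarrow> real \<Rightarrow> (real \<Rightarrow> real \<Rightarrow> real) \<Rightarrow> real" where
  "oval_integral n h P =
     (THE I. \<exists>T u y. traverses_oval n h T u y \<and>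
        ((\<lambda>t. P (u t) (y t) * deriv u t) has_integral I) {0..T})"

definition abelian_integral :: "nat \<Rightarrow> real \<Rightarrow> real \<Rightarrow> real" where
  "abelian_integral n c h = oval_integral n h (perturbation n c)"

definition limit_wave_speed :: "nat \<Rightarrow> real \<Rightarrow> real" where
  "limit_wave_speed n h = (THE c. 0 < c \<and> abelian_integral n c h = 0)"

end

theory Submission
  imports Defs
begin

text \<open>
  Write \<open>k = - h\<close> and let \<open>M j\<close> be the integral of \<open>u ^ j * y du\<close> along the oval, that is, the integral of
  \<open>u ^ j\<close> over its interior. The Abelian integral vanishes iff \<open>M n / M 0 = 1 + 1 / c\<close>, so the limit wave
  speed is \<open>M 0 / (M n - M 0)\<close> (\<open>limit_wave_speed_moments\<close>). Therefore \<open>M n / M 0\<close>, the mean of \<open>u ^ n\<close> over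
  the interior, has to exceed 1 and to increase with \<open>k\<close>. The first follows by integrating the derivative
  of \<open>y ^ 3 / u\<close> over a period (\<open>area_moment_less\<close>).

  For the second, cut the interior by the lines \<open>y = z * u\<close>. The ends of a slice have equal energy, and
  this says that the mean of \<open>u ^ n\<close> on the slice, with the area weight \<open>u du\<close>, is
  \<open>(n + 1) * (1 - z\<^sup>2)\<close>, independently of \<open>k\<close> (\<open>nn_integral_slice\<close>). So \<open>M n / M 0\<close> is \<open>n + 1\<close> times the mean of
  \<open>1 - z\<^sup>2\<close> under the density that gives the slice of slope \<open>z\<close> its weight. Multiplying \<open>u\<close> by \<open>w\<close>,
  where \<open>w ^ n = 1 - z\<^sup>2\<close>, maps the slice of slope 0 at level \<open>k / w ^ (n + 2)\<close> to the slice of slope \<open>z\<close>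
  at level \<open>k\<close>. Hence the density is \<open>w\<^sup>2 * D (k / w ^ (n + 2))\<close>, where \<open>D\<close> is half the difference of the
  squared turning points (\<open>turn_gap\<close>). In the variable \<open>p = u\<^sup>2 / 2\<close> the potential well is concave, so \<open>D\<close>
  is concave and decreasing, being the length of a superlevel set. A concave decreasing function is
  log-concave in the logarithm of its argument (\<open>concave_antimono_product_le\<close>), and for the densities this
  means that the ratio of the density at a larger \<open>k\<close> to that at a smaller \<open>k\<close> increases with \<open>1 - z\<^sup>2\<close>
  (\<open>slope_density_mlr\<close>). Raising \<open>k\<close> thus moves weight towards small slopes and raises the mean of
  \<open>1 - z\<^sup>2\<close> (\<open>monotone_likelihood_ratio_mean_less\<close>).

  The line integrals are defined through solutions, so existence and uniqueness of traversals are needed.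
  A coordinate \<open>X\<close> with \<open>y\<^sup>2 / 2 + (X u)\<^sup>2\<close> constant turns the oval into an ellipse and the flow into a
  rotation with positive speed, which is solved by separation of variables
  (\<open>oval_traversal_exists\<close>). Two traversals differ by a time shift, by Gronwall's argument
  (\<open>traversals_differ_by_shift\<close>).
\<close>

section \<open>The potential well and its turning points\<close>

text \<open>
  The Hamiltonian is \<open>y\<^sup>2 / 2 - depth n u\<close>, so the oval of energy \<open>- k\<close> bounds the region
  where \<open>y\<^sup>2 < 2 * (depth n u - k)\<close>. Minus the potential is used, and \<open>k = - h\<close> in place of \<open>h\<close>,
  so that levels, and the depth at the points of an oval, are positive.
\<close>

definition depth :: "nat \<Rightarrow> real \<Rightarrow> real" where
  "depth n u = u\<^sup>2 / 2 - u ^ (n + 2) / ((real n + 1) * (real n + 2))"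

definition centre :: "nat \<Rightarrow> real" where
  "centre n = root n (real n + 1)"

lemma hamiltonian_depth: "hamiltonian n u y = y\<^sup>2 / 2 - depth n u"
  by (simp add: hamiltonian_def depth_def)

lemma DERIV_depth [derivative_intros]:
  assumes "(f has_real_derivative D) (at x within S)"
  shows "((\<lambda>x. depth n (f x)) has_real_derivative force n (f x) * D) (at x within S)"
proof -
  have "(depth n has_real_derivative force n u) (at u)" for u
  proof -
    have "(depth n has_real_derivative
        real 2 * u ^ (2 - Suc 0) / 2 - real (n + 2) * u ^ (n + 2 - Suc 0) / ((real n + 1) * (real n + 2))) (at u)"
      unfolding depth_def [abs_def]
      by (intro DERIV_diff DERIV_cdivide DERIV_pow)
    moreover have "real (n + 2) * u ^ (n + 2 - Suc 0) / ((real n + 1) * (real n + 2)) = u ^ (n + 1) / (real n + 1)"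
      using mult_divide_mult_cancel_right [of "real n + 2" "u ^ (n + 1)" "real n + 1"]
      by (simp add: ac_simps)
    ultimately show ?thesis by (simp add: force_def)
  qed
  from DERIV_chain2 [OF this assms] show ?thesis .
qed

lemma continuous_on_depth: "continuous_on S (depth n)"
  unfolding depth_def [abs_def] by (intro continuous_intros) auto

context
  fixes n :: nat
  assumes n: "0 < n"
begin

lemma centre_pos: "0 < centre n"
  using n by (simp add: centre_def)

lemma centre_power: "centre n ^ n = real n + 1"
  using n by (simp add: centre_def)

lemma force_factor: "force n u = u * (1 - u ^ n / (real n + 1))"
  by (simp add: force_def algebra_simps)

lemma force_pos: "0 < force n u" if "0 < u" "u < centre n"
proof -
  have "u ^ n < centre n ^ n" using that n by (intro power_strict_mono) auto
  then show ?thesis using that by (simp add: force_factor centre_power)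
qed

lemma force_neg: "force n u < 0" if "centre n < u"
proof -
  have "centre n ^ n < u ^ n" using that n centre_pos by (intro power_strict_mono) auto
  then show ?thesis using that centre_pos by (simp add: force_factor centre_power mult_less_0_iff)
qed

lemma depth_strict_mono: "depth n u < depth n v" if "0 \<le> u" "u < v" "v \<le> centre n"
proof (rule DERIV_pos_imp_increasing_open [OF that(2)])
  fix x assume "u < x" "x < v"
  then have "(depth n has_real_derivative force n x) (at x)" "0 < force n x"
    using that force_pos [of x] DERIV_depth [OF DERIV_ident] by auto
  then show "\<exists>y. (depth n has_real_derivative y) (at x) \<and> 0 < y" by blast
qed (rule continuous_on_depth)

lemma depth_strict_antimono: "depth n v < depth n u" if "centre n \<le> u" "u < v"
proof (rule DERIV_neg_imp_decreasing_open [OF that(2)])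
  fix x assume "u < x" "x < v"
  then have "(depth n has_real_derivative force n x) (at x)" "force n x < 0"
    using that force_neg [of x] DERIV_depth [OF DERIV_ident] by auto
  then show "\<exists>y. (depth n has_real_derivative y) (at x) \<and> y < 0" by blast
qed (rule continuous_on_depth)

lemma depth_le_centre: "depth n u \<le> depth n (centre n)" if "0 \<le> u"
  using depth_strict_mono [of u "centre n"] depth_strict_antimono [of "centre n" u] that
  by (cases u "centre n" rule: linorder_cases) auto

lemma depth_centre:
  "depth n (centre n) = real n * (real n + 1) powr (2 / real n) / (2 * (real n + 2))"
proof -
  have "(real n + 1) powr (2 / real n) = ((real n + 1) powr (1 / real n)) powr 2"
    by (simp add: powr_powr)
  also have "\<dots> = (centre n)\<^sup>2"
    using n centre_pos by (simp add: centre_def root_powr_inverse)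
  finally have powr: "(real n + 1) powr (2 / real n) = (centre n)\<^sup>2" .
  have "centre n ^ (n + 2) = (real n + 1) * (centre n)\<^sup>2"
    using centre_power by (simp only: power_add)
  then have "centre n ^ (n + 2) / ((real n + 1) * (real n + 2)) = (centre n)\<^sup>2 / (real n + 2)"
    by (simp only:) (rule mult_divide_mult_cancel_left, simp)
  then have "depth n (centre n) = (centre n)\<^sup>2 * (1 / 2 - 1 / (real n + 2))"
    unfolding depth_def by (simp only: right_diff_distrib) simp
  also have "1 / 2 - 1 / (real n + 2) = real n / (2 * (real n + 2))"
    by (simp add: field_simps)
  finally show ?thesis by (simp add: powr)
qed

lemma energy_range_iff: "h \<in> energy_range n \<longleftrightarrow> 0 < - h \<and> - h < depth n (centre n)"
  unfolding energy_range_def depth_centre by auto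

text \<open>
  The depth climbs from 0 at the origin to its maximum at the centre and then falls below 0, since the
  power \<open>n + 2\<close> beats the square; the intermediate value theorem does the rest.
\<close>

lemma turning_points_exist:
  assumes "0 < k" "k < depth n (centre n)"
  shows "\<exists>a. 0 < a \<and> a < centre n \<and> depth n a = k" "\<exists>b. centre n < b \<and> depth n b = k"
proof -
  have d0: "depth n 0 = 0" by (simp add: depth_def)
  have "\<exists>a\<ge>0. a \<le> centre n \<and> depth n a = k"
    using assms centre_pos d0 continuous_on_depth by (intro IVT') auto
  then obtain a where "0 \<le> a" "a \<le> centre n" "depth n a = k" by blast
  then show "\<exists>a. 0 < a \<and> a < centre n \<and> depth n a = k"
    using assms d0 by (intro exI [of _ a]) (auto simp: order_le_less)
  \<comment> \<open>Beyond the denominator of the leading term, \<open>B ^ (n + 2)\<close> divided by it is at least \<open>B ^ (n + 1)\<close>,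
    which dominates \<open>B\<^sup>2 / 2\<close>.\<close>
  define B where "B = max (centre n) ((real n + 1) * (real n + 2))"
  have B: "(real n + 1) * (real n + 2) \<le> B" "centre n \<le> B"
    by (simp_all add: B_def)
  moreover have "1 \<le> (real n + 1) * (real n + 2)"
    by (simp add: algebra_simps)
  ultimately have "1 \<le> B" by linarith
  have "B\<^sup>2 \<le> B ^ (n + 1)"
    using \<open>1 \<le> B\<close> n by (intro power_increasing) auto
  moreover have "B ^ (n + 1) * ((real n + 1) * (real n + 2)) \<le> B ^ (n + 1) * B"
    using B(1) \<open>1 \<le> B\<close> by (intro mult_left_mono) auto
  then have "B ^ (n + 1) \<le> B ^ (n + 2) / ((real n + 1) * (real n + 2))"
    by (simp add: pos_le_divide_eq mult_ac)
  moreover have "0 \<le> B\<^sup>2" by simp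
  ultimately have "depth n B \<le> 0" unfolding depth_def by linarith
  then have "\<exists>b\<ge>centre n. b \<le> B \<and> depth n b = k"
    using assms B(2) continuous_on_depth by (intro IVT2') auto
  then obtain b where "centre n \<le> b" "depth n b = k" by blast
  then show "\<exists>b. centre n < b \<and> depth n b = k"
    using assms by (intro exI [of _ b]) (auto simp: order_le_less)
qed

end

text \<open>
  For \<open>k\<close> strictly between 0 and the depth of the centre, \<open>inner_turn n k\<close> and \<open>outer_turn n k\<close> are the
  two points at which the oval of energy \<open>- k\<close> meets the axis \<open>y = 0\<close>.
\<close>

definition inner_turn :: "nat \<Rightarrow> real \<Rightarrow> real" where
  "inner_turn n k = (SOME a. 0 < a \<and> a < centre n \<and> depth n a = k)"

definition outer_turn :: "nat \<Rightarrow> real \<Rightarrow> real" where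
  "outer_turn n k = (SOME b. centre n < b \<and> depth n b = k)"

context
  fixes n :: nat
  assumes n: "0 < n"
begin

lemma
  assumes "0 < k" "k < depth n (centre n)"
  shows inner_turn_pos: "0 < inner_turn n k"
    and inner_turn_less: "inner_turn n k < centre n"
    and depth_inner_turn: "depth n (inner_turn n k) = k"
    and outer_turn_gt: "centre n < outer_turn n k"
    and depth_outer_turn: "depth n (outer_turn n k) = k"
  using someI_ex [OF turning_points_exist(1) [OF n assms]]
    someI_ex [OF turning_points_exist(2) [OF n assms]]
  by (simp_all add: inner_turn_def outer_turn_def)

lemma depth_ge_iff:
  assumes "0 < k" "k < depth n (centre n)" "0 < u"
  shows "k \<le> depth n u \<longleftrightarrow> inner_turn n k \<le> u \<and> u \<le> outer_turn n k"
    and "k < depth n u \<longleftrightarrow> inner_turn n k < u \<and> u < outer_turn n k"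
proof -
  let ?a = "inner_turn n k" and ?b = "outer_turn n k"
  note t = inner_turn_pos [OF assms(1,2)] inner_turn_less [OF assms(1,2)]
    depth_inner_turn [OF assms(1,2)] outer_turn_gt [OF assms(1,2)] depth_outer_turn [OF assms(1,2)]
  have 1: "depth n u < k" if "u < ?a"
    using depth_strict_mono [OF n, of u ?a] that t assms by auto
  have 2: "depth n u < k" if "?b < u"
    using depth_strict_antimono [OF n, of ?b u] that t assms by auto
  have 3: "k < depth n u" if "?a < u" "u < ?b"
    using depth_strict_mono [OF n, of ?a u] depth_strict_antimono [OF n, of u ?b] that t
    by (cases "u \<le> centre n") auto
  show "k \<le> depth n u \<longleftrightarrow> ?a \<le> u \<and> u \<le> ?b" "k < depth n u \<longleftrightarrow> ?a < u \<and> u < ?b"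
    using 1 2 3 t by (cases u ?a rule: linorder_cases; cases u ?b rule: linorder_cases; force)+
qed

end

section \<open>Concavity of the gap between the squared turning points\<close>

text \<open>
  A concave decreasing function is log-concave in the logarithm of its argument. The proof compares
  \<open>C\<close> with the mirror image \<open>A + D - B\<close> of \<open>B\<close>: as \<open>A * D = B * C\<close>, the pair \<open>B, C\<close> has the smaller
  sum, so the mirror image lies to the right of \<open>C\<close>. Concavity bounds the sum of the values at \<open>B\<close> and
  at the mirror image from below, which forces the product up.
\<close>

lemma concave_antimono_product_le:
  fixes f :: "real \<Rightarrow> real"
  assumes conc: "concave_on S f" and anti: "antimono_on S f" and S: "{A..D} \<subseteq> S" and D: "0 \<le> f D"
    and order: "0 < A" "A \<le> B" "A \<le> C" "B \<le> D" "C \<le> D" and prod: "A * D = B * C"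
  shows "f A * f D \<le> f B * f C"
proof (cases "A = D")
  case True
  with order have "B = A" "C = A" by auto
  with True show ?thesis by simp
next
  case False
  with order have AD: "A < D" by simp
  \<comment> \<open>The mirror image of \<open>B\<close> in the midpoint of \<open>A\<close> and \<open>D\<close>.\<close>
  define C' where "C' = A + D - B"
  have C': "A \<le> C'" "C' \<le> D" using order by (auto simp: C'_def)
  have anti': "f y \<le> f x" if "A \<le> x" "x \<le> y" "y \<le> D" for x y
    using monotone_onD [OF anti, of x y] subsetD [OF S, of x] subsetD [OF S, of y] that by auto
  have "0 \<le> (D - B) * (D - C)" using order by simp
  also have "\<dots> = D * (C' - C)" using prod by (simp add: C'_def algebra_simps)
  finally have "C \<le> C'" using order AD by (simp add: zero_le_mult_iff)
  then have fC: "f C' \<le> f C" using order C' by (intro anti') auto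
  have mid: "(1 - t) * f A + t * f D \<le> f ((1 - t) * A + t * D)" if "0 \<le> t" "t \<le> 1" for t
    using concave_onD [OF conc that, of A D] subsetD [OF S, of A] subsetD [OF S, of D] AD by auto
  define t where "t = (B - A) / (D - A)"
  have t: "0 \<le> t" "t \<le> 1" using order AD by (auto simp: t_def)
  have tB: "t * (D - A) = B - A" using AD by (simp add: t_def)
  have "(1 - t) * A + t * D = B" "(1 - (1 - t)) * A + (1 - t) * D = C'"
    using tB by (simp_all add: C'_def algebra_simps)
  with mid [of t] mid [of "1 - t"] t
  have "(1 - t) * f A + t * f D \<le> f B" "t * f A + (1 - t) * f D \<le> f C'"
    by simp_all
  then have sum: "f A + f D \<le> f B + f C'" by (simp add: algebra_simps)
  have le: "f B \<le> f A" "f D \<le> f B" "0 \<le> f B"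
    using order anti' [of A B] anti' [of B D] D by auto
  have "f A * f D \<le> f A * f D + (f A - f B) * (f B - f D)" using le by simp
  also have "\<dots> = f B * (f A + f D - f B)" by (simp add: algebra_simps)
  also have "\<dots> \<le> f B * f C" using le sum fC by (intro mult_left_mono) auto
  finally show ?thesis .
qed

text \<open>
  In the variable \<open>p = u\<^sup>2 / 2\<close> this is the length of the interval on which the depth exceeds \<open>k\<close>.
\<close>

definition turn_gap :: "nat \<Rightarrow> real \<Rightarrow> real" where
  "turn_gap n k = ((outer_turn n k)\<^sup>2 - (inner_turn n k)\<^sup>2) / 2"

text \<open>
  As a function of \<open>p = u\<^sup>2 / 2\<close> the depth is \<open>p\<close> minus a positive multiple of \<open>p powr ((n + 2) / 2)\<close>,
  and this exponent is at least 1.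
\<close>

lemma depth_concave_in_square:
  assumes "0 < u" "0 < v" "0 \<le> t" "t \<le> 1"
  shows "(1 - t) * depth n u + t * depth n v \<le> depth n (sqrt ((1 - t) * u\<^sup>2 + t * v\<^sup>2))"
proof -
  let ?p = "real (n + 2) / 2" and ?w = "(1 - t) * u\<^sup>2 + t * v\<^sup>2"
  have pw: "(x\<^sup>2) powr ?p = x ^ (n + 2)" if "0 < x" for x :: real
  proof -
    have "(x\<^sup>2) powr ?p = (x powr 2) powr ?p" using that by (simp add: powr_numeral)
    also have "\<dots> = x powr (2 * ?p)" by (rule powr_powr)
    also have "2 * ?p = real (n + 2)" by simp
    also have "x powr real (n + 2) = x ^ (n + 2)" using that by (rule powr_realpow)
    finally show ?thesis .
  qed
  have w: "0 < ?w" using assms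
    by (cases "t = 0") (auto intro!: add_nonneg_pos mult_pos_pos)
  have "?w powr ?p \<le> (1 - t) * (u\<^sup>2) powr ?p + t * (v\<^sup>2) powr ?p"
    using convex_onD [OF powr_convex, of ?p t "u\<^sup>2" "v\<^sup>2"] assms by simp
  moreover have "?w powr ?p = sqrt ?w ^ (n + 2)"
    using pw [of "sqrt ?w"] w by simp
  ultimately have le: "sqrt ?w ^ (n + 2) \<le> (1 - t) * u ^ (n + 2) + t * v ^ (n + 2)"
    using pw assms by simp
  have "sqrt ?w ^ (n + 2) / ((real n + 1) * (real n + 2))
      \<le> ((1 - t) * u ^ (n + 2) + t * v ^ (n + 2)) / ((real n + 1) * (real n + 2))"
    using le by (rule divide_right_mono) simp
  moreover have "(sqrt ?w)\<^sup>2 = ?w" using w by simp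
  ultimately show ?thesis
    unfolding depth_def
    by (simp add: add_divide_distrib diff_divide_distrib right_diff_distrib left_diff_distrib)
qed

context
  fixes n :: nat
  assumes n: "0 < n"
begin

lemma turns_nested:
  assumes "0 < k" "k < l" "l < depth n (centre n)"
  shows "inner_turn n k < inner_turn n l" "outer_turn n l < outer_turn n k"
  using depth_ge_iff(2) [OF n, of k "inner_turn n l"] depth_ge_iff(2) [OF n, of k "outer_turn n l"]
    inner_turn_pos [OF n, of l] outer_turn_gt [OF n, of l] depth_inner_turn [OF n, of l]
    depth_outer_turn [OF n, of l] centre_pos [OF n] assms
  by auto

lemma turn_gap_pos: "0 < turn_gap n k" if "0 < k" "k < depth n (centre n)"
  using inner_turn_pos [OF n that] inner_turn_less [OF n that] outer_turn_gt [OF n that]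
  by (simp add: turn_gap_def power_strict_mono)

lemma antimono_turn_gap: "antimono_on {0<..<depth n (centre n)} (turn_gap n)"
proof (rule monotone_onI)
  fix k l assume kl: "k \<in> {0<..<depth n (centre n)}" "l \<in> {0<..<depth n (centre n)}" "k \<le> l"
  show "turn_gap n l \<le> turn_gap n k"
  proof (cases "k = l")
    case False
    with kl have *: "0 < k" "k < l" "l < depth n (centre n)" by auto
    note t = turns_nested [OF *] inner_turn_pos [OF n, of k] outer_turn_gt [OF n, of l] centre_pos [OF n]
    have "(inner_turn n k)\<^sup>2 \<le> (inner_turn n l)\<^sup>2" "(outer_turn n l)\<^sup>2 \<le> (outer_turn n k)\<^sup>2"
      using t * by (auto intro!: power_mono)
    then show ?thesis by (simp add: turn_gap_def)
  qed simp
qed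

text \<open>
  Superlevel sets of a concave function: the weighted mean of two inner turning points, taken in
  \<open>u\<^sup>2\<close>, still reaches the mean level, hence lies to the right of the inner turning point of that level,
  and likewise on the outer side.
\<close>

lemma concave_turn_gap: "concave_on {0<..<depth n (centre n)} (turn_gap n)"
proof -
  let ?E = "depth n (centre n)"
  have "(1 - t) * turn_gap n k + t * turn_gap n l \<le> turn_gap n ((1 - t) * k + t * l)"
    if t: "0 \<le> t" "t \<le> 1" and k: "0 < k" "k < ?E" and l: "0 < l" "l < ?E" for t k l
  proof -
    let ?m = "(1 - t) * k + t * l"
    have m: "0 < ?m" "?m < ?E"
      using convexD_alt [of "{0<..<?E}" k l t] t k l by auto
    note pos = inner_turn_pos [OF n k] inner_turn_pos [OF n l]
      inner_turn_less [OF n k] inner_turn_less [OF n l]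
      outer_turn_gt [OF n k] outer_turn_gt [OF n l] centre_pos [OF n]
    have weighted: "inner_turn n ?m \<le> sqrt ((1 - t) * u\<^sup>2 + t * v\<^sup>2)
        \<and> sqrt ((1 - t) * u\<^sup>2 + t * v\<^sup>2) \<le> outer_turn n ?m"
      if "0 < u" "0 < v" "depth n u = k" "depth n v = l" for u v
    proof -
      have "0 < (1 - t) * u\<^sup>2 + t * v\<^sup>2" using t that
        by (cases "t = 0") (auto intro!: add_nonneg_pos mult_pos_pos)
      then show ?thesis
        using depth_ge_iff(1) [OF n m] depth_concave_in_square [of u v t n] that t by auto
    qed
    have "inner_turn n ?m \<le> sqrt ((1 - t) * (inner_turn n k)\<^sup>2 + t * (inner_turn n l)\<^sup>2)"
      using weighted pos depth_inner_turn [OF n k] depth_inner_turn [OF n l] by blast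
    then have "(inner_turn n ?m)\<^sup>2 \<le> (1 - t) * (inner_turn n k)\<^sup>2 + t * (inner_turn n l)\<^sup>2"
      using inner_turn_pos [OF n m] by (simp add: real_le_rsqrt sqrt_ge_absD)
    moreover have "sqrt ((1 - t) * (outer_turn n k)\<^sup>2 + t * (outer_turn n l)\<^sup>2) \<le> outer_turn n ?m"
      using weighted [of "outer_turn n k" "outer_turn n l"] pos
        depth_outer_turn [OF n k] depth_outer_turn [OF n l] by linarith
    then have "(1 - t) * (outer_turn n k)\<^sup>2 + t * (outer_turn n l)\<^sup>2 \<le> (outer_turn n ?m)\<^sup>2"
      by (rule sqrt_le_D)
    moreover have "(1 - t) * turn_gap n k + t * turn_gap n l =
        (((1 - t) * (outer_turn n k)\<^sup>2 + t * (outer_turn n l)\<^sup>2)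
          - ((1 - t) * (inner_turn n k)\<^sup>2 + t * (inner_turn n l)\<^sup>2)) / 2"
      by (simp add: turn_gap_def diff_divide_distrib add_divide_distrib right_diff_distrib)
    ultimately show ?thesis by (simp add: turn_gap_def)
  qed
  then show ?thesis
    by (intro concave_on_linorderI) auto
qed

end

section \<open>Energy coordinate and rotation\<close>

text \<open>
  The inverse function rule in one variable, with no separate continuity assumption on the inverse.
\<close>

lemma has_real_derivative_inverse_strong:
  fixes f g :: "real \<Rightarrow> real"
  assumes "open S" "x \<in> S"
    and f: "\<And>x. x \<in> S \<Longrightarrow> (f has_real_derivative D x) (at x)"
    and gf: "\<And>x. x \<in> S \<Longrightarrow> g (f x) = x" and "D x \<noteq> 0"
  shows "(g has_real_derivative inverse (D x)) (at (f x))"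
  unfolding has_field_derivative_def
proof (rule has_derivative_inverse_strong [OF assms(1,2)])
  show "continuous_on S f"
    using f DERIV_isCont continuous_at_imp_continuous_on by blast
  show "(f has_derivative (*) (D x)) (at x)"
    using f [OF \<open>x \<in> S\<close>] by (simp add: has_field_derivative_def)
  show "(*) (D x) \<circ> (*) (inverse (D x)) = id"
    using \<open>D x \<noteq> 0\<close> by (auto simp: fun_eq_iff)
qed (use gf in auto)

text \<open>
  The autonomous equation \<open>\<Theta>' = \<omega> \<Theta>\<close> is solved by separation of variables: \<open>\<Theta>\<close> is the inverse of an
  antiderivative \<open>\<tau>\<close> of \<open>1 / \<omega>\<close>. Periodicity of \<open>\<omega>\<close> makes \<open>\<tau>\<close> grow by the same amount \<open>T\<close> over each period,
  so \<open>\<tau>\<close> is onto and one turn takes the time \<open>T\<close>.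
\<close>

lemma periodic_rotation_exists:
  fixes \<omega> :: "real \<Rightarrow> real"
  assumes cont: "continuous_on UNIV \<omega>" and pos: "\<And>x. 0 < \<omega> x"
    and per: "\<And>x. \<omega> (x + p) = \<omega> x" and p: "0 < p"
  obtains \<Theta> T where "0 < T" "\<Theta> 0 = a" "\<Theta> T = a + p" "strict_mono \<Theta>"
    "\<And>t. (\<Theta> has_real_derivative \<omega> (\<Theta> t)) (at t)"
proof -
  have "isCont (\<lambda>x. 1 / \<omega> x) x" for x
    using cont pos [of x] by (auto intro!: continuous_intros simp: continuous_on_eq_continuous_at)
  then obtain F where F: "\<And>x. (F has_real_derivative 1 / \<omega> x) (at x)"
    using einterval_antiderivative [of "-\<infinity>" \<infinity> "\<lambda>x. 1 / \<omega> x"]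
    by (auto simp: has_real_derivative_iff_has_vector_derivative)
  \<comment> \<open>\<open>\<tau> x\<close> is the time at which the rotation reaches the angle \<open>x\<close>.\<close>
  define \<tau> where "\<tau> x = F x - F a" for x
  have \<tau>: "(\<tau> has_real_derivative 1 / \<omega> x) (at x)" for x
    unfolding \<tau>_def using F by (auto intro!: derivative_eq_intros)
  then have cont_\<tau>: "continuous_on A \<tau>" for A
    using DERIV_isCont continuous_at_imp_continuous_on by blast
  have mono: "\<tau> x < \<tau> y" if "x < y" for x y
    by (rule DERIV_pos_imp_increasing [OF that]) (use \<tau> pos in \<open>auto intro!: exI\<close>)
  define T where "T = \<tau> (a + p)"
  have T: "0 < T" using mono [of a "a + p"] p by (simp add: T_def \<tau>_def)
  have "((\<lambda>x. \<tau> (x + p) - \<tau> x) has_real_derivative 0) (at x)" for x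
  proof -
    have "((\<lambda>x. \<tau> (x + p)) has_real_derivative 1 / \<omega> (x + p)) (at x)"
      using \<tau> [of "x + p"] by (simp add: DERIV_shift)
    from DERIV_diff [OF this \<tau>] show ?thesis by (simp add: per)
  qed
  then have const: "\<tau> (x + p) - \<tau> x = \<tau> (a + p) - \<tau> a" for x
    using DERIV_isconst_all [of "\<lambda>x. \<tau> (x + p) - \<tau> x"] by blast
  have step: "\<tau> (x + p) = \<tau> x + T" for x
    using const [of x] by (simp add: T_def \<tau>_def)
  have steps: "\<tau> (x + real m * p) = \<tau> x + real m * T" for x m
  proof (induction m)
    case (Suc m)
    then show ?case using step [of "x + real m * p"] by (simp add: algebra_simps)
  qed simp
  have surj: "\<exists>x. \<tau> x = t" for t
  proof -
    obtain m where m: "\<bar>t\<bar> < real m * T" using reals_Archimedean3 [OF T] by blast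
    have "\<tau> (a - real m * p) = - (real m * T)" "\<tau> (a + real m * p) = real m * T"
      using steps [of "a - real m * p" m] steps [of a m] by (simp_all add: \<tau>_def)
    moreover have "0 \<le> real m * p" using p by simp
    ultimately have "\<exists>x\<ge>a - real m * p. x \<le> a + real m * p \<and> \<tau> x = t"
      using m by (intro IVT' cont_\<tau>) linarith+
    then show ?thesis by blast
  qed
  define \<Theta> where "\<Theta> = inv \<tau>"
  have inv1: "\<Theta> (\<tau> x) = x" for x
    unfolding \<Theta>_def
    by (intro inv_f_f strict_mono_imp_inj_on strict_monoI mono)
  have inv2: "\<tau> (\<Theta> t) = t" for t
    unfolding \<Theta>_def by (rule f_inv_into_f) (use surj [of t] in blast)
  show thesis
  proof
    show "0 < T" by (rule T)
    show "\<Theta> 0 = a" "\<Theta> T = a + p" using inv1 [of a] inv1 [of "a + p"] by (simp_all add: \<tau>_def T_def)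
    show "strict_mono \<Theta>"
    proof (rule strict_monoI)
      fix s t :: real
      assume "s < t"
      then show "\<Theta> s < \<Theta> t"
        using inv2 [of s] inv2 [of t] mono [of "\<Theta> t" "\<Theta> s"]
        by (cases "\<Theta> s" "\<Theta> t" rule: linorder_cases) auto
    qed
    show "(\<Theta> has_real_derivative \<omega> (\<Theta> t)) (at t)" for t
      using has_real_derivative_inverse_strong [of UNIV "\<Theta> t" \<tau> "\<lambda>x. 1 / \<omega> x" \<Theta>] \<tau> inv1 inv2 pos [of "\<Theta> t"]
      by (simp add: less_imp_neq [symmetric])
  qed
qed

context
  fixes n :: nat
  assumes n: "0 < n"
begin

text \<open>
  The depth is a polynomial with a nondegenerate maximum at the centre. Dividing out the double root
  makes the square root of the missing depth differentiable at the centre too. The value of \<open>q\<close> at the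
  centre is half of \<open>n\<close>, read off from the derivative of the force there.
\<close>

lemma depth_quadratic_factor:
  obtains q :: "real poly" where
    "\<And>u. depth n (centre n) - depth n u = (u - centre n)\<^sup>2 * poly q u"
    "\<And>u. force n u = - (u - centre n) * (2 * poly q u + (u - centre n) * poly (pderiv q) u)"
    "\<And>u. 0 < u \<Longrightarrow> 0 < poly q u"
proof -
  let ?c = "centre n"
  define P where "P = [:depth n ?c:] - monom (1 / 2) 2 + monom (1 / ((real n + 1) * (real n + 2))) (n + 2)"
  have P: "poly P u = depth n ?c - depth n u" for u
    by (simp add: P_def depth_def poly_monom)
  have "(poly P has_real_derivative - force n u) (at u)" for u
    unfolding P [abs_def] by (auto intro!: derivative_eq_intros)
  then have P': "poly (pderiv P) u = - force n u" for u
    using DERIV_unique poly_DERIV by blast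
  have "force n ?c = 0" using centre_power [OF n] by (simp add: force_factor [OF n])
  have "[:- ?c, 1:] dvd P" using P [of ?c] by (simp add: poly_eq_0_iff_dvd)
  then obtain r where r: "P = [:- ?c, 1:] * r" by (elim dvdE)
  have "pderiv P = [:- ?c, 1:] * pderiv r + r"
    unfolding r pderiv_mult by (simp add: pderiv_pCons)
  with P' [of ?c] \<open>force n ?c = 0\<close> have "poly r ?c = 0" by simp
  then have "[:- ?c, 1:] dvd r" by (simp add: poly_eq_0_iff_dvd)
  then obtain q where q: "r = [:- ?c, 1:] * q" by (elim dvdE)
  have fac: "depth n ?c - depth n u = (u - ?c)\<^sup>2 * poly q u" for u
    using P [of u] by (simp add: r q power2_eq_square algebra_simps)
  have "((\<lambda>u. depth n ?c - depth n u) has_real_derivative - force n u) (at u)" for u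
    by (auto intro!: derivative_eq_intros)
  moreover have "((\<lambda>u. depth n ?c - depth n u) has_real_derivative
      2 * (u - ?c) * poly q u + (u - ?c)\<^sup>2 * poly (pderiv q) u) (at u)" for u
    unfolding fac by (auto intro!: derivative_eq_intros poly_DERIV)
  ultimately have eq: "- force n u = 2 * (u - ?c) * poly q u + (u - ?c)\<^sup>2 * poly (pderiv q) u" for u
    using DERIV_unique by blast
  have frc: "force n u = - (u - ?c) * (2 * poly q u + (u - ?c) * poly (pderiv q) u)" for u
  proof -
    have "force n u = - (2 * (u - ?c) * poly q u + (u - ?c)\<^sup>2 * poly (pderiv q) u)"
      using eq [of u] by linarith
    also have "\<dots> = - (u - ?c) * (2 * poly q u + (u - ?c) * poly (pderiv q) u)"
      by (simp add: power2_eq_square algebra_simps)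
    finally show ?thesis .
  qed
  \<comment> \<open>The derivative of the force at the centre, computed directly and from the factorisation.\<close>
  have "(force n has_real_derivative - real n) (at ?c)"
    unfolding force_def [abs_def]
    by (rule derivative_eq_intros refl | simp)+ (simp add: centre_power [OF n] field_simps)
  moreover have "(force n has_real_derivative - 2 * poly q ?c) (at ?c)"
    unfolding frc [abs_def] by (auto intro!: derivative_eq_intros poly_DERIV)
  ultimately have "- real n = - 2 * poly q ?c" using DERIV_unique by blast
  then have "0 < poly q ?c" using n by simp
  moreover have "0 < poly q u" if "0 < u" "u \<noteq> ?c" for u
  proof -
    have "depth n u < depth n ?c"
      using depth_strict_mono [OF n, of u ?c] depth_strict_antimono [OF n, of ?c u] that by force
    with fac [of u] have "0 < (u - ?c)\<^sup>2 * poly q u" by simp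
    then show ?thesis by (simp add: zero_less_mult_iff)
  qed
  ultimately have "0 < poly q u" if "0 < u" for u using that by (cases "u = ?c") auto
  then show thesis by (rule that [OF fac frc])
qed

text \<open>
  With \<open>X\<close> in place of \<open>u\<close> the energy relation becomes \<open>y\<^sup>2 / 2 + (X u)\<^sup>2 = const\<close>, an ellipse.
  Off the centre the derivative of \<open>X\<close> is positive because the force points towards the centre; at the
  centre it is the square root of \<open>q\<close>.
\<close>

lemma energy_coordinate_exists:
  obtains X X' :: "real \<Rightarrow> real" where
    "\<And>u. 0 < u \<Longrightarrow> (X has_real_derivative X' u) (at u)" "\<And>u. 0 < u \<Longrightarrow> 0 < X' u"
    "continuous_on {0<..} X'" "\<And>u. 0 < u \<Longrightarrow> (X u)\<^sup>2 = depth n (centre n) - depth n u"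
proof -
  obtain q :: "real poly" where
    fac: "\<And>u. depth n (centre n) - depth n u = (u - centre n)\<^sup>2 * poly q u" and
    frc: "\<And>u. force n u = - (u - centre n) * (2 * poly q u + (u - centre n) * poly (pderiv q) u)" and
    pos: "\<And>u. 0 < u \<Longrightarrow> 0 < poly q u"
    by (rule depth_quadratic_factor) (rule that)
  define X where "X u = (u - centre n) * sqrt (poly q u)" for u
  define X' where "X' u = (2 * poly q u + (u - centre n) * poly (pderiv q) u) / (2 * sqrt (poly q u))" for u
  show thesis
  proof
    fix u :: real assume u: "0 < u"
    have X': "X' u = sqrt (poly q u) + (u - centre n) * poly (pderiv q) u / (2 * sqrt (poly q u))"
      using pos [OF u] by (simp add: X'_def add_divide_distrib real_div_sqrt)
    show "(X has_real_derivative X' u) (at u)"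
    proof -
      have "((\<lambda>u. sqrt (poly q u)) has_real_derivative
          inverse (sqrt (poly q u)) / 2 * poly (pderiv q) u) (at u)"
        using pos [OF u] by (intro DERIV_chain2 [OF DERIV_real_sqrt poly_DERIV])
      moreover have "((\<lambda>u. u - centre n) has_real_derivative 1) (at u)"
        by (auto intro!: derivative_eq_intros)
      ultimately have "(X has_real_derivative
          1 * sqrt (poly q u) + inverse (sqrt (poly q u)) / 2 * poly (pderiv q) u * (u - centre n)) (at u)"
        unfolding X_def [abs_def] by (intro DERIV_mult)
      also have "1 * sqrt (poly q u) + inverse (sqrt (poly q u)) / 2 * poly (pderiv q) u * (u - centre n) = X' u"
        by (simp add: X' divide_simps)
      finally show ?thesis .
    qed
    have "0 < 2 * poly q u + (u - centre n) * poly (pderiv q) u"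
      using force_pos [OF n u] force_neg [OF n, of u] frc [of u] pos [OF u]
      by (cases u "centre n" rule: linorder_cases) (auto simp: mult_less_0_iff zero_less_mult_iff)
    then show "0 < X' u" using pos [OF u] by (simp add: X'_def)
    show "(X u)\<^sup>2 = depth n (centre n) - depth n u"
      using pos [OF u] by (simp add: X_def fac power_mult_distrib)
  next
    show "continuous_on {0<..} X'"
      unfolding X'_def by (intro continuous_intros) (use pos in force)+
  qed
qed

end

section \<open>The flow traverses the oval\<close>

context
  fixes n :: nat
  assumes n: "0 < n"
begin

text \<open>
  On the ellipse \<open>X u = \<rho> * sin x\<close>, \<open>y = sqrt 2 * \<rho> * cos x\<close> the equations of motion say that the angle
  \<open>x\<close> moves with the positive speed \<open>sqrt 2 * X' u\<close>. Rotating once therefore runs through the oval once.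
  Starting at the angle \<open>- pi / 2\<close>, the motion goes along the upper half from the inner to the outer
  turning point, which is reached at time \<open>t\<^sub>1\<close>, and back along the lower half.
\<close>

lemma oval_traversal_exists:
  assumes k: "0 < k" "k < depth n (centre n)"
  obtains T t\<^sub>1 u y where "traverses_oval n (- k) T u y" "0 < t\<^sub>1" "t\<^sub>1 < T"
    "u 0 = inner_turn n k" "u t\<^sub>1 = outer_turn n k"
    "\<And>t. t \<in> {0..t\<^sub>1} \<Longrightarrow> 0 \<le> y t" "\<And>t. t \<in> {t\<^sub>1..T} \<Longrightarrow> y t \<le> 0"
proof -
  obtain X X' :: "real \<Rightarrow> real" where
    X: "\<And>u. 0 < u \<Longrightarrow> (X has_real_derivative X' u) (at u)" and X'_pos: "\<And>u. 0 < u \<Longrightarrow> 0 < X' u" and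
    cont_X': "continuous_on {0<..} X'" and
    X_sq: "\<And>u. 0 < u \<Longrightarrow> (X u)\<^sup>2 = depth n (centre n) - depth n u"
    by (rule energy_coordinate_exists [OF n]) (rule that)
  let ?a = "inner_turn n k" and ?b = "outer_turn n k"
  note turns = inner_turn_pos [OF n k] inner_turn_less [OF n k] outer_turn_gt [OF n k]
    depth_inner_turn [OF n k] depth_outer_turn [OF n k] centre_pos [OF n]
  define \<rho> where "\<rho> = sqrt (depth n (centre n) - k)"
  have \<rho>: "0 < \<rho>" "\<rho>\<^sup>2 = depth n (centre n) - k" using k by (simp_all add: \<rho>_def)
  have X_mono: "X u < X v" if "0 < u" "u < v" for u v
  proof (rule DERIV_pos_imp_increasing [OF that(2)])
    fix x assume "u \<le> x"
    then have "0 < x" using that(1) by simp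
    then show "\<exists>y. (X has_real_derivative y) (at x) \<and> 0 < y" using X X'_pos by blast
  qed
  have Xc: "X (centre n) = 0" using X_sq [of "centre n"] turns by simp
  have Xa: "X ?a = - \<rho>" and Xb: "X ?b = \<rho>"
  proof -
    have "(X ?a)\<^sup>2 = \<rho>\<^sup>2" "(X ?b)\<^sup>2 = \<rho>\<^sup>2" using X_sq turns \<rho> by simp_all
    moreover have "X ?a < 0" "0 < X ?b" using X_mono [of ?a "centre n"] X_mono [of "centre n" ?b] Xc turns by auto
    ultimately show "X ?a = - \<rho>" "X ?b = \<rho>" using \<rho>(1) by (auto simp: power2_eq_iff)
  qed
  define \<psi> where "\<psi> = inv_into {0<..} X"
  have \<psi>X: "\<psi> (X u) = u" if "0 < u" for u
    unfolding \<psi>_def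
  proof (rule inv_into_f_f)
    show "inj_on X {0<..}"
      using X_mono by (intro strict_mono_on_imp_inj_on strict_mono_onI) auto
  qed (use that in simp)
  have X\<psi>: "X (\<psi> s) = s \<and> ?a \<le> \<psi> s \<and> \<psi> s \<le> ?b" if "\<bar>s\<bar> \<le> \<rho>" for s
  proof -
    have "continuous_on {?a..?b} X"
      using turns by (auto intro!: continuous_at_imp_continuous_on DERIV_isCont [OF X])
    then have "\<exists>u\<ge>?a. u \<le> ?b \<and> X u = s"
      using that Xa Xb turns by (intro IVT') auto
    then obtain u where u: "?a \<le> u" "u \<le> ?b" "X u = s" by blast
    with \<psi>X [of u] turns show ?thesis by auto
  qed
  have sin_le: "\<bar>\<rho> * sin x\<bar> \<le> \<rho>" for x
    using \<rho>(1) abs_sin_le_one [of x] by (simp add: abs_mult)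
  define U where "U x = \<psi> (\<rho> * sin x)" for x
  have XU: "X (U x) = \<rho> * sin x" and U_bounds: "?a \<le> U x" "U x \<le> ?b" for x
    using X\<psi> [OF sin_le [of x]] by (simp_all add: U_def)
  have U_pos: "0 < U x" for x using U_bounds(1) [of x] turns by simp
  have U_deriv: "(U has_real_derivative inverse (X' (U x)) * (\<rho> * cos x)) (at x)" for x
  proof -
    have "(\<psi> has_real_derivative inverse (X' (U x))) (at (X (U x)))"
      by (rule has_real_derivative_inverse_strong [of "{0<..}"])
        (use X \<psi>X U_pos [of x] X'_pos [of "U x"] in auto)
    then have *: "(\<psi> has_real_derivative inverse (X' (U x))) (at (\<rho> * sin x))"
      by (simp add: XU)
    have "((\<lambda>x. \<rho> * sin x) has_real_derivative \<rho> * cos x) (at x)"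
      by (auto intro!: derivative_eq_intros)
    from DERIV_chain2 [OF * this] show ?thesis by (simp add: U_def [abs_def])
  qed
  define \<omega> where "\<omega> x = sqrt 2 * X' (U x)" for x
  have "continuous_on UNIV U" using U_deriv DERIV_isCont continuous_at_imp_continuous_on by blast
  then have "continuous_on UNIV (\<lambda>x. X' (U x))"
    by (rule continuous_on_compose2 [OF cont_X']) (use U_pos in auto)
  then have "continuous_on UNIV \<omega>" unfolding \<omega>_def by (intro continuous_intros)
  moreover have "0 < \<omega> x" for x using X'_pos [OF U_pos] by (simp add: \<omega>_def)
  moreover have "\<omega> (x + 2 * pi) = \<omega> x" for x by (simp add: \<omega>_def U_def)
  ultimately obtain \<Theta> T where T: "0 < T" and \<Theta>0: "\<Theta> 0 = - (pi / 2)" and \<Theta>T: "\<Theta> T = - (pi / 2) + 2 * pi"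
    and \<Theta>_mono: "strict_mono \<Theta>"
    and \<Theta>_deriv: "\<And>t. (\<Theta> has_real_derivative \<omega> (\<Theta> t)) (at t)"
    by (rule periodic_rotation_exists [of \<omega> "2 * pi" "- (pi / 2)"]) (use pi_gt_zero in simp_all)
  define u where "u t = U (\<Theta> t)" for t
  define y where "y t = sqrt 2 * \<rho> * cos (\<Theta> t)" for t
  have cont_\<Theta>: "continuous_on A \<Theta>" for A
    using \<Theta>_deriv DERIV_isCont continuous_at_imp_continuous_on by blast
  have onto: "\<exists>t\<ge>0. t \<le> T \<and> \<Theta> t = x" if "- (pi / 2) \<le> x" "x \<le> - (pi / 2) + 2 * pi" for x
    using that \<Theta>0 \<Theta>T T cont_\<Theta> by (intro IVT') auto
  have u_deriv: "(u has_real_derivative y t) (at t)" for t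
  proof -
    have "(u has_real_derivative inverse (X' (U (\<Theta> t))) * (\<rho> * cos (\<Theta> t)) * \<omega> (\<Theta> t)) (at t)"
      unfolding u_def [abs_def] by (rule DERIV_chain2 [OF U_deriv \<Theta>_deriv])
    moreover have "inverse (X' (U (\<Theta> t))) * (\<rho> * cos (\<Theta> t)) * \<omega> (\<Theta> t) = y t"
      using X'_pos [OF U_pos, of "\<Theta> t"] by (simp add: \<omega>_def y_def)
    ultimately show ?thesis by simp
  qed
  have force_X: "force n v = - (2 * X v * X' v)" if "0 < v" for v
  proof -
    have "((\<lambda>v. (X v)\<^sup>2) has_real_derivative 2 * X v * X' v) (at v)"
      using X [OF that] by (auto intro!: derivative_eq_intros)
    moreover have "((\<lambda>v. (X v)\<^sup>2) has_real_derivative - force n v) (at v)"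
    proof (rule has_field_derivative_transform_within_open [of "\<lambda>v. depth n (centre n) - depth n v" _ _ "{0<..}"])
      show "((\<lambda>v. depth n (centre n) - depth n v) has_real_derivative - force n v) (at v)"
        by (auto intro!: derivative_eq_intros)
    qed (use that X_sq in auto)
    ultimately have "2 * X v * X' v = - force n v" by (rule DERIV_unique)
    then show ?thesis by simp
  qed
  have y_deriv: "(y has_real_derivative force n (u t)) (at t)" for t
  proof -
    have "(y has_real_derivative sqrt 2 * \<rho> * (- sin (\<Theta> t) * \<omega> (\<Theta> t))) (at t)"
      unfolding y_def [abs_def] using \<Theta>_deriv [of t] by (auto intro!: derivative_eq_intros)
    moreover have "sqrt 2 * \<rho> * (- sin (\<Theta> t) * \<omega> (\<Theta> t)) = - (sqrt 2 * sqrt 2 * X (u t) * X' (u t))"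
      by (simp only: u_def XU \<omega>_def) (simp only: mult_ac mult_minus_left mult_minus_right)
    ultimately show ?thesis
      using force_X [OF U_pos, of "\<Theta> t"] by (simp add: u_def)
  qed
  have angle: "X (u t) = \<rho> * sin (\<Theta> t)" for t by (simp add: u_def XU)
  have mem: "(u t, y t) \<in> oval n (- k)" for t
  proof -
    have "depth n (u t) = depth n (centre n) - \<rho>\<^sup>2 * (sin (\<Theta> t))\<^sup>2"
      using X_sq [OF U_pos, of "\<Theta> t"] by (simp add: u_def XU power_mult_distrib)
    moreover have "(y t)\<^sup>2 = 2 * \<rho>\<^sup>2 * (1 - (sin (\<Theta> t))\<^sup>2)"
      by (simp add: y_def power_mult_distrib cos_squared_eq)
    ultimately have "hamiltonian n (u t) (y t) = - k"
      using \<rho>(2) by (simp add: hamiltonian_depth algebra_simps)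
    then show ?thesis using U_pos by (simp add: oval_def u_def)
  qed
  have trav: "traverses_oval n (- k) T u y"
    unfolding traverses_oval_def
  proof (intro conjI allI)
    show "(u T, y T) = (u 0, y 0)"
      using sin_periodic [of "\<Theta> 0"] cos_periodic [of "\<Theta> 0"]
      by (simp only: u_def y_def U_def \<Theta>0 \<Theta>T)
    show "inj_on (\<lambda>t. (u t, y t)) {0..<T}"
    proof (rule inj_onI)
      fix s t assume st: "s \<in> {0..<T}" "t \<in> {0..<T}" and "(u s, y s) = (u t, y t)"
      then have "u s = u t" "y s = y t" by auto
      with angle [of s] angle [of t] have "sin (\<Theta> s) = sin (\<Theta> t)" "cos (\<Theta> s) = cos (\<Theta> t)"
        using \<rho>(1) by (auto simp: y_def)
      then obtain m :: int where m: "\<Theta> s = \<Theta> t + 2 * pi * m" using sin_cos_eq_iff by blast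
      have "\<Theta> 0 \<le> \<Theta> r \<and> \<Theta> r < \<Theta> T" if "r \<in> {0..<T}" for r
        using \<Theta>_mono that by (auto simp: strict_mono_less_eq strict_mono_less)
      from this [OF st(1)] this [OF st(2)] have "\<bar>2 * pi * m\<bar> < 2 * pi"
        unfolding \<Theta>0 \<Theta>T using m by linarith
      then have "\<bar>real_of_int m\<bar> < 1" by (simp add: abs_mult)
      then have "m = 0" by linarith
      with m show "s = t" using \<Theta>_mono by (simp add: strict_mono_eq)
    qed
    show "(\<lambda>t. (u t, y t)) ` {0..T} = oval n (- k)"
    proof (intro equalityI subsetI)
      fix p assume "p \<in> oval n (- k)"
      then obtain v w where p: "p = (v, w)" "0 < v" and H: "hamiltonian n v w = - k"
        by (auto simp: oval_def)
      have "(X v / \<rho>)\<^sup>2 + (w / (sqrt 2 * \<rho>))\<^sup>2 = ((X v)\<^sup>2 + w\<^sup>2 / 2) / \<rho>\<^sup>2"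
        by (simp add: power_divide power_mult_distrib add_divide_distrib)
      also have "(X v)\<^sup>2 + w\<^sup>2 / 2 = \<rho>\<^sup>2"
        using H X_sq [OF p(2)] \<rho>(2) by (simp add: hamiltonian_depth)
      finally have "(w / (sqrt 2 * \<rho>))\<^sup>2 + (X v / \<rho>)\<^sup>2 = 1" using \<rho>(1) by simp
      then obtain x where x: "0 \<le> x" "x < 2 * pi" "w / (sqrt 2 * \<rho>) = cos x" "X v / \<rho> = sin x"
        by (rule sincos_total_2pi)
      \<comment> \<open>The angle is moved from \<open>[0, 2 * pi)\<close> to the interval that starts at \<open>- pi / 2\<close>.\<close>
      define x' where "x' = (if x \<le> - (pi / 2) + 2 * pi then x else x - 2 * pi)"
      have "- (pi / 2) \<le> x'" "x' \<le> - (pi / 2) + 2 * pi"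
        using x pi_gt_zero by (auto simp: x'_def)
      then obtain t where t: "0 \<le> t" "t \<le> T" "\<Theta> t = x'" using onto by blast
      have "sin x' = X v / \<rho>" "cos x' = w / (sqrt 2 * \<rho>)"
        using x sin_periodic [of "x - 2 * pi"] cos_periodic [of "x - 2 * pi"] by (auto simp: x'_def)
      then have "X (u t) = X v" "y t = w" using \<rho>(1) t by (simp_all add: angle y_def)
      then have "u t = v" using \<psi>X [OF p(2)] \<psi>X [OF U_pos, of "\<Theta> t"] by (simp add: u_def)
      then show "p \<in> (\<lambda>t. (u t, y t)) ` {0..T}" using t p \<open>y t = w\<close> by auto
    qed (use mem in auto)
  qed (fact T u_deriv y_deriv)+
  obtain t\<^sub>1 where t1: "0 \<le> t\<^sub>1" "t\<^sub>1 \<le> T" "\<Theta> t\<^sub>1 = pi / 2"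
    using onto [of "pi / 2"] pi_gt_zero by auto
  show thesis
  proof (rule that [OF trav])
    have "\<Theta> 0 < \<Theta> t\<^sub>1" "\<Theta> t\<^sub>1 < \<Theta> T" using t1(3) \<Theta>0 \<Theta>T pi_gt_zero by linarith+
    then show "0 < t\<^sub>1" "t\<^sub>1 < T" using \<Theta>_mono by (simp_all add: strict_mono_less)
    show "u 0 = ?a" using \<psi>X [of ?a] turns Xa by (simp add: u_def U_def \<Theta>0)
    show "u t\<^sub>1 = ?b" using \<psi>X [of ?b] turns Xb by (simp add: u_def U_def t1)
    show "0 \<le> y t" if "t \<in> {0..t\<^sub>1}" for t
    proof -
      have "\<Theta> 0 \<le> \<Theta> t" "\<Theta> t \<le> \<Theta> t\<^sub>1" using that \<Theta>_mono by (auto simp: strict_mono_less_eq)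
      then have "0 \<le> cos (\<Theta> t)" unfolding \<Theta>0 t1 by (intro cos_ge_zero) auto
      then show ?thesis using \<rho>(1) by (simp add: y_def)
    qed
    show "y t \<le> 0" if "t \<in> {t\<^sub>1..T}" for t
    proof -
      have "\<Theta> t\<^sub>1 \<le> \<Theta> t" "\<Theta> t \<le> \<Theta> T" using that \<Theta>_mono by (auto simp: strict_mono_less_eq)
      then have "0 \<le> cos (\<Theta> t - pi)" unfolding \<Theta>T t1 by (intro cos_ge_zero) auto
      then have "cos (\<Theta> t) \<le> 0" by (simp add: cos_diff)
      then show ?thesis using \<rho>(1) by (simp add: y_def mult_le_0_iff)
    qed
  qed
qed

end

section \<open>Uniqueness of solutions\<close>

text \<open>
  Multiplying by \<open>exp (- C * t)\<close> gives a decreasing function and multiplying by \<open>exp (C * t)\<close> an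
  increasing one, which covers the times after and before \<open>s\<close>.
\<close>

lemma gronwall_zero:
  fixes e e' :: "real \<Rightarrow> real"
  assumes deriv: "\<And>t. (e has_real_derivative e' t) (at t)"
    and bound: "\<And>t. \<bar>e' t\<bar> \<le> C * e t" and nonneg: "\<And>t. 0 \<le> e t" and zero: "e s = 0"
  shows "e t = 0"
proof -
  have fwd: "((\<lambda>t. e t * exp (- C * t)) has_real_derivative (e' t - C * e t) * exp (- C * t)) (at t)" for t
    using deriv [of t] by (auto intro!: derivative_eq_intros simp: algebra_simps)
  have bwd: "((\<lambda>t. e t * exp (C * t)) has_real_derivative (e' t + C * e t) * exp (C * t)) (at t)" for t
    using deriv [of t] by (auto intro!: derivative_eq_intros simp: algebra_simps)
  have sgn: "(e' t - C * e t) * exp (- C * t) \<le> 0" "0 \<le> (e' t + C * e t) * exp (C * t)" for t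
    using bound [of t] by (auto simp: mult_le_0_iff abs_le_iff)
  have "e t \<le> 0"
  proof (cases "s \<le> t")
    case True
    have "e t * exp (- C * t) \<le> e s * exp (- C * s)"
      by (rule DERIV_nonpos_imp_nonincreasing [OF True]) (use fwd sgn in blast)
    then show ?thesis using zero by (simp add: mult_le_0_iff)
  next
    case False
    then have "t \<le> s" by simp
    then have "e t * exp (C * t) \<le> e s * exp (C * s)"
      by (rule DERIV_nonneg_imp_nondecreasing) (use bwd sgn in blast)
    then show ?thesis using zero by (simp add: mult_le_0_iff)
  qed
  with nonneg [of t] show ?thesis by simp
qed

definition kdv_solution :: "nat \<Rightarrow> (real \<Rightarrow> real) \<Rightarrow> (real \<Rightarrow> real) \<Rightarrow> bool" where
  "kdv_solution n u y \<longleftrightarrow>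
     (\<forall>t. (u has_real_derivative y t) (at t)) \<and> (\<forall>t. (y has_real_derivative force n (u t)) (at t))"

lemma kdv_solution_shift:
  assumes "kdv_solution n u y"
  shows "kdv_solution n (\<lambda>t. u (t + s)) (\<lambda>t. y (t + s))"
  using assms unfolding kdv_solution_def by (simp flip: DERIV_shift)

lemma kdv_solution_energy:
  assumes "kdv_solution n u y"
  shows "hamiltonian n (u t) (y t) = hamiltonian n (u 0) (y 0)"
proof -
  have "((\<lambda>t. hamiltonian n (u t) (y t)) has_real_derivative 0) (at t)" for t
    using assms unfolding hamiltonian_depth kdv_solution_def
    by (auto intro!: derivative_eq_intros)
  then show ?thesis using DERIV_isconst_all by blast
qed

context
  fixes n :: nat
  assumes n: "0 < n"
begin

lemma oval_iff:
  shows "(u, y) \<in> oval n h \<longleftrightarrow> 0 < u \<and> y\<^sup>2 = 2 * (depth n u + h)"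
  by (auto simp: oval_def hamiltonian_depth field_simps)

text \<open>
  On the oval \<open>depth n u\<close> is at least \<open>- h\<close>, because the kinetic term is nonnegative.
\<close>

lemma oval_bounds:
  assumes "h \<in> energy_range n" "(u, y) \<in> oval n h"
  shows "inner_turn n (- h) \<le> u" "u \<le> outer_turn n (- h)"
proof -
  have "0 < u" "0 \<le> depth n u + h"
    using assms(2) zero_le_power2 [of y] by (auto simp: oval_def hamiltonian_depth simp del: zero_le_power2)
  then show "inner_turn n (- h) \<le> u" "u \<le> outer_turn n (- h)"
    using depth_ge_iff(1) [OF n, of "- h" u] assms(1) by (auto simp: energy_range_iff [OF n])
qed

text \<open>
  At \<open>u = 0\<close> the energy is nonnegative, so a solution of negative energy cannot leave the half plane
  \<open>u > 0\<close>.
\<close>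

lemma kdv_solution_stays_on_oval:
  assumes h: "h \<in> energy_range n" and sol: "kdv_solution n u y" and start: "(u 0, y 0) \<in> oval n h"
  shows "(u t, y t) \<in> oval n h"
proof -
  have H: "hamiltonian n (u t) (y t) = h" for t
    using kdv_solution_energy [OF sol] start by (simp add: oval_def)
  have nz: "u t \<noteq> 0" for t
  proof
    assume "u t = 0"
    with H [of t] have "(y t)\<^sup>2 = 2 * h" by (simp add: hamiltonian_def)
    moreover have "h < 0" using h by (simp add: energy_range_iff [OF n])
    ultimately show False using zero_le_power2 [of "y t"] by linarith
  qed
  have cont: "continuous_on A u" for A
    using sol DERIV_isCont continuous_at_imp_continuous_on unfolding kdv_solution_def by blast
  have u0: "0 < u 0" using start by (simp add: oval_def)
  have "0 < u t"
  proof (rule ccontr)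
    assume "\<not> 0 < u t"
    then have t: "u t \<le> 0" "0 \<le> u 0" using u0 by simp_all
    have "\<exists>s. u s = 0"
    proof (cases "t \<le> 0")
      case True
      then show ?thesis using IVT' [OF t True cont] by blast
    next
      case False
      then show ?thesis using IVT2' [OF t _ cont] by fastforce
    qed
    with nz show False by blast
  qed
  with H show ?thesis by (simp add: oval_def)
qed

lemma force_lipschitz:
  obtains L where "0 \<le> L" "\<And>u v. u \<in> {0..B} \<Longrightarrow> v \<in> {0..B} \<Longrightarrow> \<bar>force n u - force n v\<bar> \<le> L * \<bar>u - v\<bar>"
proof -
  have "((\<lambda>x. force n x) has_real_derivative
      1 - real (n + 1) * x ^ (n + 1 - Suc 0) / (real n + 1)) (at x within {0..B})" for x
    unfolding force_def by (intro DERIV_diff DERIV_ident DERIV_cdivide DERIV_pow)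
  then have D: "((\<lambda>x. force n x) has_real_derivative 1 - x ^ n) (at x within {0..B})" for x
    by (simp add: add.commute)
  have "\<bar>force n u - force n v\<bar> \<le> (1 + \<bar>B\<bar> ^ n) * \<bar>u - v\<bar>" if "u \<in> {0..B}" "v \<in> {0..B}" for u v
  proof -
    have "norm (force n u - force n v) \<le> (1 + \<bar>B\<bar> ^ n) * norm (u - v)"
    proof (rule field_differentiable_bound [OF convex_real_interval(5) D])
      fix z assume "z \<in> {0..B}"
      then have "0 \<le> z ^ n" "z ^ n \<le> \<bar>B\<bar> ^ n" by (auto intro!: power_mono)
      then show "norm (1 - z ^ n) \<le> 1 + \<bar>B\<bar> ^ n" by simp
    qed (use that in auto)
    then show ?thesis by simp
  qed
  moreover have "0 \<le> 1 + \<bar>B\<bar> ^ n" by simp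
  ultimately show thesis using that by blast
qed

text \<open>
  The force is Lipschitz on the bounded range of \<open>u\<close>, so the squared distance of the two solutions
  satisfies the hypothesis of \<open>gronwall_zero\<close>.
\<close>

lemma kdv_solution_unique:
  assumes h: "h \<in> energy_range n"
    and sol1: "kdv_solution n u\<^sub>1 y\<^sub>1" and sol2: "kdv_solution n u\<^sub>2 y\<^sub>2"
    and start: "(u\<^sub>1 0, y\<^sub>1 0) \<in> oval n h" "(u\<^sub>2 0, y\<^sub>2 0) \<in> oval n h"
    and meet: "(u\<^sub>1 s, y\<^sub>1 s) = (u\<^sub>2 s, y\<^sub>2 s)"
  shows "(u\<^sub>1 t, y\<^sub>1 t) = (u\<^sub>2 t, y\<^sub>2 t)"
proof -
  obtain L where L: "0 \<le> L" and lip: "\<And>u v. u \<in> {0..outer_turn n (- h)} \<Longrightarrow> v \<in> {0..outer_turn n (- h)} \<Longrightarrow>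
      \<bar>force n u - force n v\<bar> \<le> L * \<bar>u - v\<bar>"
    by (rule force_lipschitz) (rule that)
  have range: "u\<^sub>1 t \<in> {0..outer_turn n (- h)}" "u\<^sub>2 t \<in> {0..outer_turn n (- h)}" for t
    using kdv_solution_stays_on_oval [OF h sol1 start(1), of t] kdv_solution_stays_on_oval [OF h sol2 start(2), of t]
      oval_bounds(2) [OF h] by (auto simp: oval_def)
  define e where "e t = (u\<^sub>1 t - u\<^sub>2 t)\<^sup>2 + (y\<^sub>1 t - y\<^sub>2 t)\<^sup>2" for t
  define e' where "e' t = 2 * ((u\<^sub>1 t - u\<^sub>2 t) * (y\<^sub>1 t - y\<^sub>2 t))
      + 2 * ((y\<^sub>1 t - y\<^sub>2 t) * (force n (u\<^sub>1 t) - force n (u\<^sub>2 t)))" for t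
  have "e t = 0"
  proof (rule gronwall_zero [of e e' "1 + L" s])
    show "(e has_real_derivative e' t) (at t)" for t
      unfolding e_def [abs_def] e'_def using sol1 sol2
      by (auto simp: kdv_solution_def algebra_simps intro!: derivative_eq_intros)
    show "\<bar>e' t\<bar> \<le> (1 + L) * e t" for t
    proof -
      let ?p = "\<bar>u\<^sub>1 t - u\<^sub>2 t\<bar>" and ?q = "\<bar>y\<^sub>1 t - y\<^sub>2 t\<bar>"
      have "\<bar>e' t\<bar> \<le> 2 * (?p * ?q) + 2 * (?q * \<bar>force n (u\<^sub>1 t) - force n (u\<^sub>2 t)\<bar>)"
        unfolding e'_def by (rule order_trans [OF abs_triangle_ineq]) (simp only: abs_mult abs_numeral)
      also have "\<dots> \<le> 2 * (?p * ?q) + 2 * (?q * (L * ?p))"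
        using lip [OF range] by (intro add_left_mono mult_left_mono) auto
      also have "\<dots> = (1 + L) * (2 * ?p * ?q)" by (simp add: algebra_simps)
      also have "\<dots> \<le> (1 + L) * (?p\<^sup>2 + ?q\<^sup>2)"
        using L sum_squares_bound [of ?p ?q] by (intro mult_left_mono) auto
      finally show ?thesis by (simp add: e_def)
    qed
    show "e s = 0" using meet by (simp add: e_def)
  qed (simp add: e_def)
  then show ?thesis by (simp add: e_def sum_power2_eq_zero_iff)
qed

end

section \<open>Line integrals along the oval\<close>

text \<open>
  The piece of the integral that leaves at the left end comes back, moved by one period, at the right end.
\<close>

lemma has_integral_periodic_shift:
  fixes f :: "real \<Rightarrow> real"
  assumes f: "(f has_integral I) {0..T}" and per: "\<And>t. f (t + T) = f t" and s: "0 \<le> s" "s \<le> T"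
  shows "((\<lambda>t. f (t + s)) has_integral I) {0..T}"
proof -
  have "f integrable_on {0..T}" using f by blast
  then have "f integrable_on {0..s}" "f integrable_on {s..T}"
    using s by (auto intro: integrable_on_subinterval)
  then obtain A B where A: "(f has_integral A) {0..s}" and B: "(f has_integral B) {s..T}" by blast
  have "f \<circ> (+) T = f" using per by (auto simp: add.commute)
  with A have "((f \<circ> (+) T) has_integral A) {0..s}" by simp
  then have "(f has_integral A) {T..s + T}" by (simp add: has_integral_shift_Icc_real)
  from has_integral_combine [OF _ _ B this] s have "(f has_integral (B + A)) {0 + s..T + s}"
    by (simp add: add.commute)
  then have "((f \<circ> (+) s) has_integral (B + A)) {0..T}" by (simp only: has_integral_shift_Icc_real)
  moreover have "I = A + B" by (rule has_integral_unique [OF f has_integral_combine [OF s A B]])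
  moreover have "f \<circ> (+) s = (\<lambda>t. f (t + s))" by (simp add: fun_eq_iff add.commute)
  ultimately show ?thesis by (simp add: add.commute)
qed

lemma traverses_oval_solution: "traverses_oval n h T u y \<Longrightarrow> kdv_solution n u y"
  by (simp add: traverses_oval_def kdv_solution_def)

lemma traverses_oval_mem: "traverses_oval n h T u y \<Longrightarrow> t \<in> {0..T} \<Longrightarrow> (u t, y t) \<in> oval n h"
  unfolding traverses_oval_def by blast

context
  fixes n :: nat
  assumes n: "0 < n"
begin

lemma traversal_return_is_period:
  assumes h: "h \<in> energy_range n" and trav: "traverses_oval n h T u y"
    and ret: "u (r + p) = u r" "y (r + p) = y r"
  shows "u (t + p) = u t" "y (t + p) = y t"
proof -
  note sol = traverses_oval_solution [OF trav]
  have start: "(u 0, y 0) \<in> oval n h"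
    using traverses_oval_mem [OF trav, of 0] trav by (simp add: traverses_oval_def)
  have "(u (0 + p), y (0 + p)) \<in> oval n h"
    using kdv_solution_stays_on_oval [OF n h sol start, of p] by simp
  from kdv_solution_unique [OF n h kdv_solution_shift [OF sol, of p] sol this start, of r t] ret
  show "u (t + p) = u t" "y (t + p) = y t" by auto
qed

text \<open>
  The second traversal starts at a point that the first one passes at some time \<open>s\<close>; by uniqueness it is
  the first one delayed. Both are then periodic with both periods, and since neither returns early the
  periods agree.
\<close>

lemma traversals_differ_by_shift:
  assumes h: "h \<in> energy_range n"
    and trav1: "traverses_oval n h T\<^sub>1 u\<^sub>1 y\<^sub>1" and trav2: "traverses_oval n h T\<^sub>2 u\<^sub>2 y\<^sub>2"
  obtains s where "0 \<le> s" "s \<le> T\<^sub>1" "T\<^sub>2 = T\<^sub>1"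
    "\<And>t. u\<^sub>2 t = u\<^sub>1 (t + s)" "\<And>t. y\<^sub>2 t = y\<^sub>1 (t + s)"
proof -
  have T: "0 < T\<^sub>1" "0 < T\<^sub>2" using trav1 trav2 by (auto simp: traverses_oval_def)
  have inj: "inj_on (\<lambda>t. (u\<^sub>1 t, y\<^sub>1 t)) {0..<T\<^sub>1}" "inj_on (\<lambda>t. (u\<^sub>2 t, y\<^sub>2 t)) {0..<T\<^sub>2}"
    using trav1 trav2 by (simp_all add: traverses_oval_def)
  have start: "(u\<^sub>2 0, y\<^sub>2 0) \<in> oval n h" using traverses_oval_mem [OF trav2, of 0] T by simp
  moreover have "oval n h = (\<lambda>t. (u\<^sub>1 t, y\<^sub>1 t)) ` {0..T\<^sub>1}" using trav1 by (simp add: traverses_oval_def)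
  ultimately have "(u\<^sub>2 0, y\<^sub>2 0) \<in> (\<lambda>t. (u\<^sub>1 t, y\<^sub>1 t)) ` {0..T\<^sub>1}" by simp
  then obtain s where s: "0 \<le> s" "s \<le> T\<^sub>1" and eq: "u\<^sub>2 0 = u\<^sub>1 s" "y\<^sub>2 0 = y\<^sub>1 s"
    by auto
  have "(u\<^sub>2 t, y\<^sub>2 t) = (u\<^sub>1 (t + s), y\<^sub>1 (t + s))" for t
    using kdv_solution_unique [OF n h traverses_oval_solution [OF trav2]
        kdv_solution_shift [OF traverses_oval_solution [OF trav1], of s] start, of 0 t] start eq
    by simp
  then have shift: "u\<^sub>2 t = u\<^sub>1 (t + s)" "y\<^sub>2 t = y\<^sub>1 (t + s)" for t by auto
  have per1: "u\<^sub>1 (t + T\<^sub>1) = u\<^sub>1 t" "y\<^sub>1 (t + T\<^sub>1) = y\<^sub>1 t" for t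
    using traversal_return_is_period [OF h trav1, of 0 T\<^sub>1 t] trav1 by (auto simp: traverses_oval_def)
  have "u\<^sub>1 (s + T\<^sub>2) = u\<^sub>1 s" "y\<^sub>1 (s + T\<^sub>2) = y\<^sub>1 s"
    using trav2 shift [of T\<^sub>2] eq by (auto simp: traverses_oval_def add.commute)
  from traversal_return_is_period [OF h trav1 this, of 0]
  have "(u\<^sub>1 T\<^sub>2, y\<^sub>1 T\<^sub>2) = (u\<^sub>1 0, y\<^sub>1 0)" by simp
  then have "\<not> T\<^sub>2 < T\<^sub>1"
    using inj_onD [OF inj(1), of T\<^sub>2 0] T by auto
  moreover have "(u\<^sub>2 T\<^sub>1, y\<^sub>2 T\<^sub>1) = (u\<^sub>2 0, y\<^sub>2 0)"
    using shift [of T\<^sub>1] shift [of 0] per1 [of s] by (simp add: add.commute)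
  then have "\<not> T\<^sub>1 < T\<^sub>2"
    using inj_onD [OF inj(2), of T\<^sub>1 0] T by auto
  ultimately have "T\<^sub>2 = T\<^sub>1" by simp
  with s shift show thesis by (intro that)
qed

text \<open>
  By \<open>traversals_differ_by_shift\<close> and periodicity, one traversal determines the definite description.
\<close>

lemma oval_integral_eqI:
  assumes h: "h \<in> energy_range n" and trav: "traverses_oval n h T u y"
    and I: "((\<lambda>t. P (u t) (y t) * y t) has_integral I) {0..T}"
  shows "oval_integral n h P = I"
  unfolding oval_integral_def
proof (rule the_equality)
  have deriv: "deriv u = y" if "traverses_oval n h T u y" for T u y
    using that by (auto simp: traverses_oval_def fun_eq_iff intro: DERIV_imp_deriv)
  show "\<exists>T u y. traverses_oval n h T u y \<and> ((\<lambda>t. P (u t) (y t) * deriv u t) has_integral I) {0..T}"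
    using trav I by (intro exI [of _ T] exI [of _ u] exI [of _ y]) (simp add: deriv [OF trav])
  fix J
  assume "\<exists>T u y. traverses_oval n h T u y \<and> ((\<lambda>t. P (u t) (y t) * deriv u t) has_integral J) {0..T}"
  then obtain T' u' y' where trav': "traverses_oval n h T' u' y'"
    and "((\<lambda>t. P (u' t) (y' t) * deriv u' t) has_integral J) {0..T'}"
    by blast
  then have J: "((\<lambda>t. P (u' t) (y' t) * y' t) has_integral J) {0..T'}"
    using deriv [OF trav'] by simp
  obtain s where s: "0 \<le> s" "s \<le> T" "T' = T"
    and shift: "\<And>t. u' t = u (t + s)" "\<And>t. y' t = y (t + s)"
    by (rule traversals_differ_by_shift [OF h trav trav']) (rule that)
  have "u (t + T) = u t" "y (t + T) = y t" for t
    using traversal_return_is_period [OF h trav, of 0 T t] trav by (auto simp: traverses_oval_def)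
  then have "((\<lambda>t. P (u (t + s)) (y (t + s)) * y (t + s)) has_integral I) {0..T}"
    using has_integral_periodic_shift [OF I _ s(1,2)] by simp
  then show "J = I" using has_integral_unique J unfolding shift s(3) by blast
qed

end

section \<open>Moments of the oval and the limit wave speed\<close>

text \<open>
  The integral of \<open>u ^ j\<close> over the interior of the oval of energy \<open>- k\<close> with respect to area.
\<close>

definition area_moment :: "nat \<Rightarrow> real \<Rightarrow> nat \<Rightarrow> real" where
  "area_moment n k j =
     integral {inner_turn n k..outer_turn n k} (\<lambda>u. 2 * (u ^ j * sqrt (2 * (depth n u - k))))"

context
  fixes n :: nat and k :: real
  assumes n: "0 < n" and k: "0 < k" "k < depth n (centre n)"
begin

lemma minus_in_energy_range: "- k \<in> energy_range n"
  using k by (simp add: energy_range_iff [OF n])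

text \<open>
  Substituting \<open>u\<close> for \<open>t\<close> on the upper and on the lower half of the oval, each half contributes the same
  amount: on the lower half both \<open>y\<close> and the direction of \<open>u\<close> change sign.
\<close>

lemma traversal_with_moments_exists:
  obtains T u y where "traverses_oval n (- k) T u y"
    "\<And>j. ((\<lambda>t. u t ^ j * y t * y t) has_integral area_moment n k j) {0..T}"
proof -
  obtain T t\<^sub>1 u y where trav: "traverses_oval n (- k) T u y" and t1: "0 < t\<^sub>1" "t\<^sub>1 < T"
    and ends: "u 0 = inner_turn n k" "u t\<^sub>1 = outer_turn n k"
    and y_pos: "\<And>t. t \<in> {0..t\<^sub>1} \<Longrightarrow> 0 \<le> y t" and y_neg: "\<And>t. t \<in> {t\<^sub>1..T} \<Longrightarrow> y t \<le> 0"
    by (rule oval_traversal_exists [OF n k]) (rule that)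
  let ?a = "inner_turn n k" and ?b = "outer_turn n k"
  define Y where "Y v = sqrt (2 * (depth n v - k))" for v
  have uT: "u T = ?a" using trav ends by (simp add: traverses_oval_def)
  have du: "(u has_real_derivative y t) (at t within A)" for t A
    using trav by (auto simp: traverses_oval_def intro: has_field_derivative_at_within)
  have cont_u: "continuous_on A u" for A
    using du DERIV_isCont continuous_at_imp_continuous_on by blast
  have bounds: "u t \<in> {?a..?b}" if "t \<in> {0..T}" for t
    using oval_bounds [OF n minus_in_energy_range traverses_oval_mem [OF trav that]] by simp
  have ab: "?a \<le> ?b" using bounds [of t\<^sub>1] t1 ends by simp
  have y_abs: "Y (u t) = \<bar>y t\<bar>" if "t \<in> {0..T}" for t
  proof -
    have "(y t)\<^sup>2 = 2 * (depth n (u t) - k)"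
      using traverses_oval_mem [OF trav that] oval_iff [OF n] by simp
    then show ?thesis by (simp add: Y_def flip: real_sqrt_abs)
  qed
  have moment: "((\<lambda>t. u t ^ j * y t * y t) has_integral area_moment n k j) {0..T}" for j
  proof -
    let ?f = "\<lambda>v. v ^ j * Y v"
    have cont_f: "continuous_on {?a..?b} ?f"
      unfolding Y_def by (intro continuous_intros continuous_on_depth)
    have "((\<lambda>t. y t *\<^sub>R ?f (u t)) has_integral integral {u 0..u t\<^sub>1} ?f - integral {u t\<^sub>1..u 0} ?f) {0..t\<^sub>1}"
      by (rule has_integral_substitution_general [of "{}", where c = ?a and d = ?b])
        (use t1 bounds cont_f cont_u du in auto)
    moreover have "integral {?b..?a} ?f = 0"
      using ab by (cases "?a = ?b") (auto simp: ends)
    ultimately have "((\<lambda>t. y t * ?f (u t)) has_integral integral {?a..?b} ?f) {0..t\<^sub>1}"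
      by (simp add: ends)
    then have 1: "((\<lambda>t. u t ^ j * y t * y t) has_integral integral {?a..?b} ?f) {0..t\<^sub>1}"
      by (rule has_integral_eq [rotated]) (use y_abs y_pos t1 in auto)
    have "((\<lambda>t. y t *\<^sub>R ?f (u t)) has_integral integral {u t\<^sub>1..u T} ?f - integral {u T..u t\<^sub>1} ?f) {t\<^sub>1..T}"
      by (rule has_integral_substitution_general [of "{}", where c = ?a and d = ?b])
        (use t1 bounds cont_f cont_u du in auto)
    moreover have "integral {?b..?a} ?f = 0"
      using ab by (cases "?a = ?b") (auto simp: ends)
    ultimately have "((\<lambda>t. y t * ?f (u t)) has_integral - integral {?a..?b} ?f) {t\<^sub>1..T}"
      by (simp add: ends uT)
    from has_integral_neg [OF this]
    have "((\<lambda>t. - (y t * ?f (u t))) has_integral integral {?a..?b} ?f) {t\<^sub>1..T}" by simp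
    then have 2: "((\<lambda>t. u t ^ j * y t * y t) has_integral integral {?a..?b} ?f) {t\<^sub>1..T}"
      by (rule has_integral_eq [rotated]) (use y_abs y_neg t1 in auto)
    have "area_moment n k j = integral {?a..?b} ?f + integral {?a..?b} ?f"
      unfolding area_moment_def Y_def by simp
    with has_integral_combine [OF _ _ 1 2] t1 show ?thesis by simp
  qed
  show thesis by (rule that [OF trav moment])
qed

lemma area_moment_0_pos: "0 < area_moment n k 0"
proof -
  let ?a = "inner_turn n k" and ?b = "outer_turn n k" and ?f = "\<lambda>u. 2 * (u ^ 0 * sqrt (2 * (depth n u - k)))"
  have c: "?a < centre n" "centre n < ?b"
    using inner_turn_less [OF n k] outer_turn_gt [OF n k] by auto
  have cont: "continuous_on {?a..?b} ?f" by (intro continuous_intros continuous_on_depth)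
  have nonneg: "0 \<le> ?f u" if "u \<in> {?a..?b}" for u
    using depth_ge_iff(1) [OF n k, of u] inner_turn_pos [OF n k] that by auto
  have "integral {?a..?b} ?f \<noteq> 0"
  proof
    assume "integral {?a..?b} ?f = 0"
    then have "?f (centre n) = 0"
      using integral_eq_0_iff [OF cont, of] nonneg c by fastforce
    then show False using k by simp
  qed
  moreover have "0 \<le> integral {?a..?b} ?f"
    using cont nonneg by (intro integral_nonneg integrable_continuous_real) auto
  ultimately show ?thesis unfolding area_moment_def by simp
qed

text \<open>
  The derivative of \<open>y ^ 3 / u\<close> along the flow integrates to 0 over one turn. Expressed by the energy
  relation it is \<open>2 * y\<^sup>2 - c * u ^ n * y\<^sup>2\<close> plus the nonnegative term \<open>2 * k * y\<^sup>2 / u\<^sup>2\<close>, where \<open>c < 2\<close>.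
  Hence the moment of order \<open>n\<close> is at least \<open>2 / c\<close> times the area.
\<close>

lemma area_moment_less: "area_moment n k 0 < area_moment n k n"
proof -
  obtain T u y where trav: "traverses_oval n (- k) T u y"
    and mom: "\<And>j. ((\<lambda>t. u t ^ j * y t * y t) has_integral area_moment n k j) {0..T}"
    by (rule traversal_with_moments_exists) (rule that)
  \<comment> \<open>The coefficient \<open>3 / (n + 1) - 2 / ((n + 1) * (n + 2))\<close> of \<open>u ^ n * y\<^sup>2\<close> in the derivative of \<open>y ^ 3 / u\<close>,
    up to sign.\<close>
  define c where "c = (3 * real n + 4) / ((real n + 1) * (real n + 2))"
  have T: "0 < T" and ret: "u T = u 0" "y T = y 0"
    and du: "\<And>t. (u has_real_derivative y t) (at t)" and dy: "\<And>t. (y has_real_derivative force n (u t)) (at t)"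
    using trav by (auto simp: traverses_oval_def)
  let ?G = "\<lambda>t. 3 * (y t)\<^sup>2 * force n (u t) / u t - (y t) ^ 4 / (u t)\<^sup>2"
  have "((\<lambda>t. (y t) ^ 3 / u t) has_vector_derivative ?G t) (at t within {0..T})" if "t \<in> {0..T}" for t
  proof -
    have "u t \<noteq> 0" using traverses_oval_mem [OF trav that] by (auto simp: oval_def)
    then have "((\<lambda>t. (y t) ^ 3 / u t) has_real_derivative ?G t) (at t)"
      using du [of t] dy [of t]
      by (auto intro!: derivative_eq_intros simp: field_simps power2_eq_square power4_eq_xxxx power3_eq_cube)
    then show ?thesis
      by (simp add: has_field_derivative_at_within flip: has_real_derivative_iff_has_vector_derivative)
  qed
  from fundamental_theorem_of_calculus [OF _ this] T ret have G_int: "(?G has_integral 0) {0..T}" by simp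
  have mom_diff: "((\<lambda>t. 2 * (u t ^ 0 * y t * y t) - c * (u t ^ n * y t * y t)) has_integral
      2 * area_moment n k 0 - c * area_moment n k n) {0..T}"
    by (intro has_integral_diff has_integral_mult_right mom)
  have G_ge: "2 * (u t ^ 0 * y t * y t) - c * (u t ^ n * y t * y t) \<le> ?G t" if "t \<in> {0..T}" for t
  proof -
    have u: "0 < u t" and e: "(y t)\<^sup>2 = 2 * (depth n (u t) - k)"
      using traverses_oval_mem [OF trav that] oval_iff [OF n] by auto
    let ?p = "real n + 1" and ?q = "real n + 2"
    have "(y t) ^ 4 / (u t)\<^sup>2 = (y t)\<^sup>2 * ((y t)\<^sup>2 / (u t)\<^sup>2)"
      by (simp add: power4_eq_xxxx power2_eq_square)
    also have "(y t)\<^sup>2 / (u t)\<^sup>2 = 1 - 2 * u t ^ n / (?p * ?q) - 2 * k / (u t)\<^sup>2"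
      unfolding e depth_def using u by (simp add: diff_divide_distrib right_diff_distrib power2_eq_square)
    also have "\<dots> \<le> 1 - 2 * u t ^ n / (?p * ?q)" using k by simp
    finally have "(y t) ^ 4 / (u t)\<^sup>2 \<le> (y t)\<^sup>2 * (1 - 2 * u t ^ n / (?p * ?q))"
      by (simp add: mult_left_mono)
    moreover have "3 * (y t)\<^sup>2 * force n (u t) / u t = (y t)\<^sup>2 * (3 - 3 * u t ^ n / ?p)"
    proof -
      have "force n (u t) / u t = 1 - u t ^ n / ?p" using u by (simp add: force_factor [OF n])
      then have "3 * (y t)\<^sup>2 * (force n (u t) / u t) = 3 * (y t)\<^sup>2 * (1 - u t ^ n / ?p)"
        by (simp only:)
      also have "\<dots> = (y t)\<^sup>2 * (3 - 3 * u t ^ n / ?p)"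
        by (simp add: algebra_simps)
      finally show ?thesis by simp
    qed
    moreover have cu: "c * u t ^ n = 3 * u t ^ n / ?p - 2 * u t ^ n / (?p * ?q)"
    proof -
      have "c = 3 / ?p - 2 / (?p * ?q)" 
        unfolding c_def by (simp add: divide_simps)
      then show ?thesis by (simp add: left_diff_distrib)
    qed
    have "2 * (u t ^ 0 * y t * y t) - c * (u t ^ n * y t * y t) = (y t)\<^sup>2 * (2 - c * u t ^ n)"
      by (simp add: power2_eq_square algebra_simps)
    then have "2 * (u t ^ 0 * y t * y t) - c * (u t ^ n * y t * y t)
        = (y t)\<^sup>2 * (3 - 3 * u t ^ n / ?p) - (y t)\<^sup>2 * (1 - 2 * u t ^ n / (?p * ?q))"
      unfolding cu by (simp only: right_diff_distrib)
    ultimately show ?thesis by linarith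
  qed
  have le: "2 * area_moment n k 0 - c * area_moment n k n \<le> 0"
    by (rule has_integral_le [OF mom_diff G_int G_ge])
  have "2 * ((real n + 1) * (real n + 2)) = 3 * real n + 4 + (2 * (real n * real n) + 3 * real n)"
    by (simp add: algebra_simps)
  moreover have "0 < 2 * (real n * real n) + 3 * real n" using n by (simp add: add_pos_pos)
  ultimately have "3 * real n + 4 < 2 * ((real n + 1) * (real n + 2))" by linarith
  then have c: "c < 2" "0 < c" unfolding c_def by (simp_all add: pos_divide_less_eq)
  show ?thesis
  proof (rule ccontr)
    assume "\<not> area_moment n k 0 < area_moment n k n"
    then have "c * area_moment n k n \<le> c * area_moment n k 0" using c by simp
    also have "\<dots> < 2 * area_moment n k 0" using c area_moment_0_pos by simp
    finally show False using le by simp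
  qed
qed

text \<open>
  The Abelian integral is \<open>sqrt c\<close> times \<open>M n - (1 + 1 / c) * M 0\<close> with the moments \<open>M j\<close>, which is
  solved for \<open>c\<close>; the solution is positive by \<open>area_moment_less\<close>.
\<close>

lemma limit_wave_speed_moments:
  "limit_wave_speed n (- k) = area_moment n k 0 / (area_moment n k n - area_moment n k 0)"
proof -
  obtain T u y where trav: "traverses_oval n (- k) T u y"
    and mom: "\<And>j. ((\<lambda>t. u t ^ j * y t * y t) has_integral area_moment n k j) {0..T}"
    by (rule traversal_with_moments_exists) (rule that)
  let ?N = "area_moment n k"
  have abel: "abelian_integral n c (- k) = sqrt c * (?N n - (1 + 1 / c) * ?N 0)" for c
  proof -
    have "((\<lambda>t. sqrt c * (u t ^ n * y t * y t - (1 + 1 / c) * (u t ^ 0 * y t * y t))) has_integral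
        sqrt c * (?N n - (1 + 1 / c) * ?N 0)) {0..T}"
      by (intro has_integral_diff has_integral_mult_right mom)
    then have "((\<lambda>t. perturbation n c (u t) (y t) * y t) has_integral
        sqrt c * (?N n - (1 + 1 / c) * ?N 0)) {0..T}"
      by (simp add: perturbation_def algebra_simps)
    then show ?thesis
      unfolding abelian_integral_def by (rule oval_integral_eqI [OF n minus_in_energy_range trav])
  qed
  show ?thesis
    unfolding limit_wave_speed_def abel
  proof (rule the_equality)
    show "0 < ?N 0 / (?N n - ?N 0) \<and> sqrt (?N 0 / (?N n - ?N 0)) *
        (?N n - (1 + 1 / (?N 0 / (?N n - ?N 0))) * ?N 0) = 0"
      using area_moment_0_pos area_moment_less by (simp add: field_simps)
  next
    fix c assume c: "0 < c \<and> sqrt c * (?N n - (1 + 1 / c) * ?N 0) = 0"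
    then have "?N n - (1 + 1 / c) * ?N 0 = 0" by auto
    then show "c = ?N 0 / (?N n - ?N 0)"
      using c area_moment_less by (simp add: field_simps)
  qed
qed

end

section \<open>Slicing the interior of the oval by lines through the origin\<close>

text \<open>
  The interior of the oval in the coordinates \<open>u\<close> and \<open>z = y / u\<close>; the area element is \<open>u * du * dz\<close>.
\<close>

definition slope_region :: "nat \<Rightarrow> real \<Rightarrow> (real \<times> real) set" where
  "slope_region n k = {(u, z). 0 < u \<and> u\<^sup>2 * z\<^sup>2 < 2 * (depth n u - k)}"

text \<open>
  Replacing \<open>u\<close> by \<open>slope_scale n z * v\<close> turns the energy along the line \<open>y = z * u\<close> into the energy along
  the axis \<open>y = 0\<close>, up to the factor \<open>slope_scale n z ^ (n + 2)\<close>; see \<open>slope_region_scaled\<close>.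
\<close>

definition slope_scale :: "nat \<Rightarrow> real \<Rightarrow> real" where
  "slope_scale n z = root n (1 - z\<^sup>2)"

text \<open>
  The weight \<open>\<integral> u du\<close> of the slice of the interior with slope \<open>z\<close>, in closed form; the second alternative
  is the case of an empty slice. See \<open>nn_integral_slice\<close>.
\<close>

definition slope_density :: "nat \<Rightarrow> real \<Rightarrow> real \<Rightarrow> real" where
  "slope_density n k z =
     (if \<bar>z\<bar> < 1 \<and> k / slope_scale n z ^ (n + 2) < depth n (centre n)
      then (slope_scale n z)\<^sup>2 * turn_gap n (k / slope_scale n z ^ (n + 2)) else 0)"

lemma nn_integral_power_Ioo:
  fixes a b :: real
  assumes "0 \<le> a" "a \<le> b"
  shows "(\<integral>\<^sup>+ u. ennreal (u ^ m) * indicator {a<..<b} u \<partial>lborel) = ennreal ((b ^ Suc m - a ^ Suc m) / Suc m)"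
proof (rule nn_integral_has_integral_lebesgue')
  have "((\<lambda>u. u ^ Suc m / Suc m) has_vector_derivative u ^ m) (at u within {a..b})" for u
    by (auto intro!: derivative_eq_intros simp: has_real_derivative_iff_has_vector_derivative [symmetric] simp del: power_Suc)
  from fundamental_theorem_of_calculus [OF assms(2) this]
  show "((\<lambda>u. u ^ m) has_integral (b ^ Suc m - a ^ Suc m) / Suc m) {a<..<b}"
    by (simp add: has_integral_Icc_iff_Ioo diff_divide_distrib)
qed (use assms in auto)

context
  fixes n :: nat
  assumes n: "0 < n"
begin

lemma slope_scale_power: "\<bar>z\<bar> \<le> 1 \<Longrightarrow> slope_scale n z ^ n = 1 - z\<^sup>2"
  using n by (simp add: slope_scale_def abs_square_le_1)

lemma slope_scale_pos: "\<bar>z\<bar> < 1 \<Longrightarrow> 0 < slope_scale n z"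
  using n by (simp add: slope_scale_def abs_square_less_1)

lemma slope_scale_le: "slope_scale n z \<le> slope_scale n x" if "1 - z\<^sup>2 \<le> 1 - x\<^sup>2"
  using that n by (simp add: slope_scale_def)

end

context
  fixes n :: nat and k :: real
  assumes n: "0 < n" and k: "0 < k" "k < depth n (centre n)"
begin

lemma slope_region_measurable [measurable]: "Measurable.pred (lborel \<Otimes>\<^sub>M lborel) (\<lambda>p. p \<in> slope_region n k)"
  unfolding slope_region_def depth_def by measurable

lemma nn_integral_slope_section:
  "(\<integral>\<^sup>+ z. ennreal (u ^ Suc j) * indicator (slope_region n k) (u, z) \<partial>lborel)
    = ennreal (2 * (u ^ j * sqrt (2 * (depth n u - k)))) * indicator {inner_turn n k..outer_turn n k} u"
proof (cases "u \<in> {inner_turn n k..outer_turn n k}")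
  case True
  let ?Y = "sqrt (2 * (depth n u - k))"
  from True have u: "0 < u" and d: "0 \<le> 2 * (depth n u - k)"
    using inner_turn_pos [OF n k] depth_ge_iff(1) [OF n k, of u] by auto
  have "(u, z) \<in> slope_region n k \<longleftrightarrow> z \<in> {- (?Y / u)<..<?Y / u}" for z
  proof -
    have "(u, z) \<in> slope_region n k \<longleftrightarrow> (u * z)\<^sup>2 < ?Y\<^sup>2"
      using u d by (simp add: slope_region_def power_mult_distrib)
    also have "\<dots> \<longleftrightarrow> \<bar>u * z\<bar> < ?Y"
      using d abs_le_square_iff [of ?Y "u * z"] by (auto simp: not_le [symmetric])
    also have "\<dots> \<longleftrightarrow> z \<in> {- (?Y / u)<..<?Y / u}"
      using u by (auto simp: abs_less_iff field_simps)
    finally show ?thesis .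
  qed
  then have "(\<integral>\<^sup>+ z. ennreal (u ^ Suc j) * indicator (slope_region n k) (u, z) \<partial>lborel)
      = (\<integral>\<^sup>+ z. ennreal (u ^ Suc j) * indicator {- (?Y / u)<..<?Y / u} z \<partial>lborel)"
    by (intro nn_integral_cong) (simp add: indicator_def)
  also have "\<dots> = ennreal (u ^ Suc j) * ennreal (2 * (?Y / u))"
    using u d by (subst nn_integral_cmult) auto
  also have "\<dots> = ennreal (2 * (u ^ j * ?Y))"
    using u by (simp add: field_simps flip: ennreal_mult')
  finally show ?thesis using True by simp
next
  case False
  have "(u, z) \<notin> slope_region n k" for z
  proof
    assume "(u, z) \<in> slope_region n k"
    then have u: "0 < u" "u\<^sup>2 * z\<^sup>2 < 2 * (depth n u - k)" by (auto simp: slope_region_def)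
    have "0 < 2 * (depth n u - k)" by (rule le_less_trans [OF _ u(2)]) simp
    then have "k \<le> depth n u" by simp
    with u(1) show False using depth_ge_iff(1) [OF n k, of u] False by auto
  qed
  then show ?thesis using False by simp
qed

text \<open>
  For fixed \<open>u\<close> the slopes form an interval of length \<open>2 * sqrt (2 * (depth n u - k)) / u\<close>. Exchanging
  the order of integration leaves the slices of fixed slope.
\<close>

lemma area_moment_as_double_integral:
  "ennreal (area_moment n k j)
    = (\<integral>\<^sup>+ z. \<integral>\<^sup>+ u. ennreal (u ^ Suc j) * indicator (slope_region n k) (u, z) \<partial>lborel \<partial>lborel)"
proof -
  let ?a = "inner_turn n k" and ?b = "outer_turn n k"
  have "(\<integral>\<^sup>+ z. \<integral>\<^sup>+ u. ennreal (u ^ Suc j) * indicator (slope_region n k) (u, z) \<partial>lborel \<partial>lborel)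
      = (\<integral>\<^sup>+ u. \<integral>\<^sup>+ z. ennreal (u ^ Suc j) * indicator (slope_region n k) (u, z) \<partial>lborel \<partial>lborel)"
    by (rule lborel_pair.Fubini') measurable
  also have "\<dots> = (\<integral>\<^sup>+ u. ennreal (2 * (u ^ j * sqrt (2 * (depth n u - k)))) * indicator {?a..?b} u \<partial>lborel)"
    by (simp only: nn_integral_slope_section)
  also have "\<dots> = ennreal (area_moment n k j)"
    unfolding area_moment_def
  proof (rule nn_integral_has_integral_lebesgue')
    show "((\<lambda>u. 2 * (u ^ j * sqrt (2 * (depth n u - k)))) has_integral
        integral {?a..?b} (\<lambda>u. 2 * (u ^ j * sqrt (2 * (depth n u - k))))) {?a..?b}"
      by (intro integrable_integral integrable_continuous_real continuous_intros continuous_on_depth)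
    show "0 \<le> 2 * (u ^ j * sqrt (2 * (depth n u - k)))" if "u \<in> {?a..?b}" for u
      using that inner_turn_pos [OF n k] depth_ge_iff(1) [OF n k, of u] by auto
  qed
  finally show ?thesis by simp
qed

lemma slope_region_scaled:
  assumes z: "\<bar>z\<bar> < 1" and v: "0 < v"
  shows "(slope_scale n z * v, z) \<in> slope_region n k \<longleftrightarrow> k / slope_scale n z ^ (n + 2) < depth n v"
proof -
  let ?w = "slope_scale n z"
  have w: "0 < ?w" "?w ^ n = 1 - z\<^sup>2" using slope_scale_pos [OF n] slope_scale_power [OF n] z by auto
  then have wn: "?w ^ (n + 2) = ?w\<^sup>2 * (1 - z\<^sup>2)" by (simp add: power_add power2_eq_square)
  have "(?w * v, z) \<in> slope_region n k \<longleftrightarrow> k < depth n (?w * v) - (?w * v)\<^sup>2 * z\<^sup>2 / 2"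
    using w v by (auto simp: slope_region_def)
  also have "depth n (?w * v) - (?w * v)\<^sup>2 * z\<^sup>2 / 2 = ?w ^ (n + 2) * depth n v"
    unfolding depth_def by (simp only: power_mult_distrib wn) (simp add: algebra_simps diff_divide_distrib)
  also have "k < ?w ^ (n + 2) * depth n v \<longleftrightarrow> k / ?w ^ (n + 2) < depth n v"
    using w(1) by (simp only: pos_divide_less_eq zero_less_power mult.commute)
  finally show ?thesis .
qed

lemma slope_section_eq:
  assumes z: "\<bar>z\<bar> < 1" and l: "l = k / slope_scale n z ^ (n + 2)" "l < depth n (centre n)"
  shows "(u, z) \<in> slope_region n k \<longleftrightarrow>
    u \<in> {slope_scale n z * inner_turn n l<..<slope_scale n z * outer_turn n l}"
proof -
  let ?w = "slope_scale n z"
  have w: "0 < ?w" using slope_scale_pos [OF n] z by auto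
  have l0: "0 < l" using k w by (simp add: l)
  define v where "v = u / ?w"
  have uv: "u = ?w * v" using w by (simp add: v_def)
  show ?thesis
  proof (cases "0 < v")
    case True
    then show ?thesis
      using slope_region_scaled [OF z True] depth_ge_iff(2) [OF n l0 l(2) True] w
      by (simp add: uv l(1))
  next
    case False
    then have "u \<le> 0" using w by (simp add: uv mult_le_0_iff)
    moreover have "0 < ?w * inner_turn n l" using w inner_turn_pos [OF n l0 l(2)] by simp
    ultimately show ?thesis by (auto simp: slope_region_def)
  qed
qed

lemma slope_section_empty:
  assumes "\<not> (\<bar>z\<bar> < 1 \<and> k / slope_scale n z ^ (n + 2) < depth n (centre n))"
  shows "(u, z) \<notin> slope_region n k"
proof
  assume mem: "(u, z) \<in> slope_region n k"
  then have u: "0 < u" "u\<^sup>2 * z\<^sup>2 < 2 * (depth n u - k)" by (auto simp: slope_region_def)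
  have "0 < u ^ (n + 2) / ((real n + 1) * (real n + 2))" using u(1) by simp
  moreover have "2 * (u\<^sup>2 / 2 - x - k) < u\<^sup>2" if "0 < x" for x
    using that k(1) by simp
  ultimately have "2 * (depth n u - k) < u\<^sup>2" unfolding depth_def by blast
  with u(2) have "u\<^sup>2 * z\<^sup>2 < u\<^sup>2 * 1" by (simp only: mult_1_right order.strict_trans)
  then have "z\<^sup>2 < 1" using u(1) by (simp only: mult_less_cancel_left_pos zero_less_power)
  then have z: "\<bar>z\<bar> < 1" by (simp add: abs_square_less_1)
  let ?w = "slope_scale n z"
  have w: "0 < ?w" using slope_scale_pos [OF n] z by auto
  have "k / ?w ^ (n + 2) < depth n (u / ?w)"
    using slope_region_scaled [OF z, of "u / ?w"] mem u(1) w by simp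
  also have "\<dots> \<le> depth n (centre n)" using u(1) w by (intro depth_le_centre [OF n]) simp
  finally show False using assms z by simp
qed

lemma slope_density_nonneg: "0 \<le> slope_density n k z"
proof (cases "\<bar>z\<bar> < 1 \<and> k / slope_scale n z ^ (n + 2) < depth n (centre n)")
  case True
  then have "0 < turn_gap n (k / slope_scale n z ^ (n + 2))"
    using k slope_scale_pos [OF n] by (intro turn_gap_pos [OF n]) auto
  then show ?thesis by (simp add: slope_density_def)
next
  case False
  show ?thesis unfolding slope_density_def if_not_P [OF False] by simp
qed

text \<open>
  The two ends of a slice have the same energy, which ties the difference of their powers \<open>n + 2\<close> to
  the difference of their squares. So on each slice, whatever the level \<open>k\<close>, the mean of \<open>u ^ n\<close> with
  the weight \<open>u du\<close> is \<open>(n + 1) * (1 - z\<^sup>2)\<close>.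
\<close>

lemma nn_integral_slice:
  "(\<integral>\<^sup>+ u. ennreal (u ^ Suc 0) * indicator (slope_region n k) (u, z) \<partial>lborel)
     = ennreal (slope_density n k z)" (is ?th0)
  "(\<integral>\<^sup>+ u. ennreal (u ^ Suc n) * indicator (slope_region n k) (u, z) \<partial>lborel)
     = ennreal ((real n + 1) * ((1 - z\<^sup>2) * slope_density n k z))" (is ?thn)
proof -
  have "?th0 \<and> ?thn"
  proof (cases "\<bar>z\<bar> < 1 \<and> k / slope_scale n z ^ (n + 2) < depth n (centre n)")
    case False
    then show ?thesis using slope_section_empty [OF False] by (auto simp: slope_density_def)
  next
    case True
    let ?w = "slope_scale n z"
    define l where "l = k / ?w ^ (n + 2)"
    let ?a = "inner_turn n l" and ?b = "outer_turn n l"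
    from True have z: "\<bar>z\<bar> < 1" and lE: "l < depth n (centre n)" by (auto simp: l_def)
    have w: "0 < ?w" "?w ^ n = 1 - z\<^sup>2" using slope_scale_pos [OF n] slope_scale_power [OF n] z by auto
    then have wn: "?w ^ (n + 2) = ?w\<^sup>2 * (1 - z\<^sup>2)" by (simp add: power_add power2_eq_square)
    have l0: "0 < l" using k w(1) by (simp add: l_def)
    have ab: "0 < ?a" "?a < ?b"
      using inner_turn_pos [OF n l0 lE] inner_turn_less [OF n l0 lE] outer_turn_gt [OF n l0 lE] by auto
    have S: "slope_density n k z = ?w\<^sup>2 * turn_gap n l" using True by (simp add: slope_density_def l_def)
    have slice: "(\<integral>\<^sup>+ u. ennreal (u ^ m) * indicator (slope_region n k) (u, z) \<partial>lborel)
        = ennreal (((?w * ?b) ^ Suc m - (?w * ?a) ^ Suc m) / Suc m)" for m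
    proof -
      have "(\<integral>\<^sup>+ u. ennreal (u ^ m) * indicator (slope_region n k) (u, z) \<partial>lborel)
          = (\<integral>\<^sup>+ u. ennreal (u ^ m) * indicator {?w * ?a<..<?w * ?b} u \<partial>lborel)"
        by (intro nn_integral_cong) (simp add: indicator_def slope_section_eq [OF z l_def lE])
      also have "\<dots> = ennreal (((?w * ?b) ^ Suc m - (?w * ?a) ^ Suc m) / Suc m)"
        using w ab by (intro nn_integral_power_Ioo) auto
      finally show ?thesis .
    qed
    have "((?w * ?b) ^ Suc (Suc 0) - (?w * ?a) ^ Suc (Suc 0)) / Suc (Suc 0) = slope_density n k z"
      unfolding S turn_gap_def by (simp add: power2_eq_square algebra_simps)
    then have th0: ?th0 using slice [of "Suc 0"] by simp
    have "(?b ^ (n + 2) - ?a ^ (n + 2)) / (real n + 2) = (real n + 1) * turn_gap n l"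
    proof -
      have "depth n ?a = depth n ?b" using depth_inner_turn [OF n l0 lE] depth_outer_turn [OF n l0 lE] by simp
      then have "turn_gap n l = (?b ^ (n + 2) - ?a ^ (n + 2)) / ((real n + 1) * (real n + 2))"
        unfolding depth_def turn_gap_def by (simp add: diff_divide_distrib)
      moreover have "x / (real n + 2) = (real n + 1) * (x / ((real n + 1) * (real n + 2)))" for x
        by simp
      ultimately show ?thesis by (simp only:)
    qed
    moreover have "(?w * ?b) ^ (n + 2) - (?w * ?a) ^ (n + 2) = ?w ^ (n + 2) * (?b ^ (n + 2) - ?a ^ (n + 2))"
      by (simp only: power_mult_distrib right_diff_distrib)
    ultimately have "((?w * ?b) ^ (n + 2) - (?w * ?a) ^ (n + 2)) / (real n + 2)
        = ?w ^ (n + 2) * ((real n + 1) * turn_gap n l)"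
      by (simp only: times_divide_eq_right [symmetric])
    also have "\<dots> = (real n + 1) * ((1 - z\<^sup>2) * slope_density n k z)"
      unfolding wn S by (simp only: mult_ac)
    finally have "((?w * ?b) ^ (n + 2) - (?w * ?a) ^ (n + 2)) / (real n + 2)
        = (real n + 1) * ((1 - z\<^sup>2) * slope_density n k z)" .
    moreover have "Suc (Suc n) = n + 2" "real (n + 2) = real n + 2" by simp_all
    ultimately have ?thn using slice [of "Suc n"] by (simp only:)
    with th0 show ?thesis by blast
  qed
  then show ?th0 ?thn by auto
qed

lemma slope_density_measurable [measurable]: "slope_density n k \<in> borel_measurable lborel"
proof -
  have "(\<lambda>z. enn2real (\<integral>\<^sup>+ u. ennreal (u ^ Suc 0) * indicator (slope_region n k) (u, z) \<partial>lborel))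
      \<in> borel_measurable lborel"
    by measurable
  then show ?thesis by (simp only: nn_integral_slice(1) enn2real_ennreal slope_density_nonneg)
qed

lemma area_moment_0_slopes:
  "integrable lborel (slope_density n k)" "area_moment n k 0 = (\<integral>z. slope_density n k z \<partial>lborel)"
proof -
  have nn: "(\<integral>\<^sup>+ z. ennreal (slope_density n k z) \<partial>lborel) = ennreal (area_moment n k 0)"
    by (simp only: area_moment_as_double_integral nn_integral_slice)
  then show int: "integrable lborel (slope_density n k)"
    by (intro integrableI_nn_integral_finite slope_density_measurable)
      (auto simp: slope_density_nonneg)
  have "ennreal (area_moment n k 0) = ennreal (\<integral>z. slope_density n k z \<partial>lborel)"
    using nn_integral_eq_integral [OF int] by (simp add: slope_density_nonneg nn)
  then show "area_moment n k 0 = (\<integral>z. slope_density n k z \<partial>lborel)"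
    using area_moment_0_pos [OF n k] by (simp add: slope_density_nonneg)
qed

lemma area_moment_n_slopes:
  "integrable lborel (\<lambda>z. (1 - z\<^sup>2) * slope_density n k z)"
  "area_moment n k n = (real n + 1) * (\<integral>z. (1 - z\<^sup>2) * slope_density n k z \<partial>lborel)"
proof -
  let ?f = "\<lambda>z. (real n + 1) * ((1 - z\<^sup>2) * slope_density n k z)"
  have nonneg: "0 \<le> ?f z" for z
  proof (cases "\<bar>z\<bar> < 1")
    case True
    then have "z\<^sup>2 \<le> 1" by (simp add: abs_square_le_1)
    then show ?thesis by (simp add: slope_density_nonneg)
  next
    case False
    then show ?thesis by (simp add: slope_density_def)
  qed
  have nn: "(\<integral>\<^sup>+ z. ennreal (?f z) \<partial>lborel) = ennreal (area_moment n k n)"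
    by (simp only: area_moment_as_double_integral nn_integral_slice)
  have meas: "?f \<in> borel_measurable lborel"
    using slope_density_measurable by measurable
  have int: "integrable lborel ?f"
    by (rule integrableI_nn_integral_finite [OF meas _ nn]) (use nonneg in simp)
  then show "integrable lborel (\<lambda>z. (1 - z\<^sup>2) * slope_density n k z)"
    by (rule integrable_mult_left_iff [THEN iffD1, THEN disjE]) simp_all
  have "ennreal (area_moment n k n) = ennreal (\<integral>z. ?f z \<partial>lborel)"
    using nn_integral_eq_integral [OF int] nonneg by (simp only: nn) simp
  moreover have "0 \<le> (\<integral>z. ?f z \<partial>lborel)" by (rule Bochner_Integration.integral_nonneg [OF nonneg])
  moreover have "0 \<le> area_moment n k n"
    using area_moment_0_pos [OF n k] area_moment_less [OF n k] by simp
  ultimately have "area_moment n k n = (\<integral>z. ?f z \<partial>lborel)"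
    using ennreal_inj by blast
  then show "area_moment n k n = (real n + 1) * (\<integral>z. (1 - z\<^sup>2) * slope_density n k z \<partial>lborel)"
    by simp
qed

end

section \<open>Monotone likelihood ratio of the slope densities\<close>

text \<open>
  If the ratio of the weights \<open>f\<close> and \<open>g\<close> increases with \<open>w\<close>, then \<open>w\<close> has the larger mean under \<open>f\<close>.
  The product of \<open>w x - w z\<close> and \<open>f x * g z - f z * g x\<close> is nonnegative; its integral over \<open>x\<close> is
  \<open>Q z\<close>, and the integral of \<open>Q\<close> is twice the difference of the two sides. Strictness comes from a set
  \<open>U\<close> of positive measure that lies below the support of \<open>f\<close> but inside the support of \<open>g\<close>.
\<close>

lemma monotone_likelihood_ratio_mean_less:
  fixes w f g :: "'a \<Rightarrow> real"
  assumes f: "integrable M f" "integrable M (\<lambda>z. w z * f z)"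
    and g: "integrable M g" "integrable M (\<lambda>z. w z * g z)"
    and f_nonneg: "\<And>z. 0 \<le> f z" and f_pos: "(\<integral>z. f z \<partial>M) \<noteq> 0"
    and mlr: "\<And>z x. w z \<le> w x \<Longrightarrow> f z * g x \<le> f x * g z"
    and U: "U \<in> sets M" "emeasure M U \<noteq> 0"
    and below: "\<And>z. z \<in> U \<Longrightarrow> f z = 0 \<and> 0 < g z \<and> (\<forall>x. f x \<noteq> 0 \<longrightarrow> w z < w x)"
  shows "(\<integral>z. w z * g z \<partial>M) * (\<integral>z. f z \<partial>M) < (\<integral>z. w z * f z \<partial>M) * (\<integral>z. g z \<partial>M)"
proof -
  define F where "F = (\<integral>z. f z \<partial>M)"
  define Fw where "Fw = (\<integral>z. w z * f z \<partial>M)"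
  define G where "G = (\<integral>z. g z \<partial>M)"
  define Gw where "Gw = (\<integral>z. w z * g z \<partial>M)"
  \<comment> \<open>The sum of the four integrals over \<open>x\<close> in \<open>Q_inner\<close>.\<close>
  define Q where "Q z = g z * Fw - (w z * g z) * F - f z * Gw + (w z * f z) * G" for z
  have Q_int: "integrable M Q" unfolding Q_def using f g by simp
  have Q_eq: "(\<integral>z. Q z \<partial>M) = 2 * (Fw * G - Gw * F)"
    unfolding Q_def using f g by (simp flip: F_def Fw_def G_def Gw_def)
  have Q_inner: "Q z = (\<integral>x. (w x - w z) * (f x * g z - f z * g x) \<partial>M)" for z
  proof -
    have "(\<integral>x. (w x - w z) * (f x * g z - f z * g x) \<partial>M)
        = (\<integral>x. g z * (w x * f x) - (w z * g z) * f x - f z * (w x * g x) + (w z * f z) * g x \<partial>M)"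
      by (rule Bochner_Integration.integral_cong) (auto simp: algebra_simps)
    also have "\<dots> = Q z"
      unfolding Q_def F_def Fw_def G_def Gw_def using f g by simp
    finally show ?thesis by simp
  qed
  have Q_nonneg: "0 \<le> Q z" for z
  proof -
    have "0 \<le> (w x - w z) * (f x * g z - f z * g x)" for x
      using mlr [of z x] mlr [of x z]
      by (cases "w z \<le> w x") (auto intro: mult_nonneg_nonneg mult_nonpos_nonpos simp: mult.commute)
    then show ?thesis unfolding Q_inner by (rule Bochner_Integration.integral_nonneg)
  qed
  have Q_pos: "0 < Q z" if "z \<in> U" for z
  proof -
    note z = below [OF that]
    have "Q z = g z * (\<integral>x. (w x - w z) * f x \<partial>M)"
      using z f by (simp add: Q_def F_def Fw_def left_diff_distrib algebra_simps)
    moreover have int: "integrable M (\<lambda>x. (w x - w z) * f x)"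
      using f by (simp add: left_diff_distrib)
    have nonneg: "0 \<le> (w x - w z) * f x" for x
      using z f_nonneg [of x] by (cases "f x = 0") (auto intro!: mult_nonneg_nonneg less_imp_le)
    have "(\<integral>x. (w x - w z) * f x \<partial>M) \<noteq> 0"
    proof
      assume "(\<integral>x. (w x - w z) * f x \<partial>M) = 0"
      then have "AE x in M. (w x - w z) * f x = 0"
        using integral_nonneg_eq_0_iff_AE [OF int] nonneg by simp
      then have "AE x in M. f x = 0"
        by (rule AE_mp) (use z in \<open>auto intro!: AE_I2\<close>)
      then have "(\<integral>x. f x \<partial>M) = 0" by (rule integral_eq_zero_AE)
      with f_pos show False ..
    qed
    moreover have "0 \<le> (\<integral>x. (w x - w z) * f x \<partial>M)"
      using nonneg by (rule Bochner_Integration.integral_nonneg)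
    ultimately show ?thesis using z by simp
  qed
  have "(\<integral>z. Q z \<partial>M) \<noteq> 0"
  proof
    assume "(\<integral>z. Q z \<partial>M) = 0"
    then have "AE z in M. Q z = 0"
      using integral_nonneg_eq_0_iff_AE [OF Q_int] Q_nonneg by simp
    then have "AE z in M. z \<notin> U"
      by (rule AE_mp) (use Q_pos in \<open>force intro!: AE_I2\<close>)
    then have "emeasure M U = 0" using U(1) by (subst (asm) AE_iff_measurable [of U]) (use sets.sets_into_space in auto)
    with U(2) show False ..
  qed
  moreover have "0 \<le> (\<integral>z. Q z \<partial>M)" using Q_nonneg by (rule Bochner_Integration.integral_nonneg)
  ultimately show ?thesis unfolding Q_eq F_def Fw_def G_def Gw_def by simp
qed

context
  fixes n :: nat
  assumes n: "0 < n"
begin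

text \<open>
  Up to the squared scales, the four densities are values of \<open>turn_gap\<close> at \<open>k\<close> and \<open>l\<close> divided by two
  powers of scales, so the products of the outer and of the inner arguments agree and
  \<open>concave_antimono_product_le\<close> applies.
\<close>

lemma slope_density_mlr:
  assumes k: "0 < l" "l < k" "k < depth n (centre n)" and zx: "1 - z\<^sup>2 \<le> 1 - x\<^sup>2"
  shows "slope_density n k z * slope_density n l x \<le> slope_density n k x * slope_density n l z"
proof (cases "\<bar>z\<bar> < 1 \<and> k / slope_scale n z ^ (n + 2) < depth n (centre n)")
  case False
  then have "slope_density n k z = 0" unfolding slope_density_def by (rule if_not_P)
  then show ?thesis using slope_density_nonneg [OF n] k by simp
next
  case True
  let ?E = "depth n (centre n)" and ?v = "slope_scale n z" and ?w = "slope_scale n x"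
  from True have z: "\<bar>z\<bar> < 1" and kE: "k / ?v ^ (n + 2) < ?E" by auto
  have "\<bar>x\<bar> \<le> \<bar>z\<bar>" using zx by (simp add: abs_le_square_iff)
  with z have x: "\<bar>x\<bar> < 1" by simp
  have v: "0 < ?v" and vw: "?v \<le> ?w" using slope_scale_pos [OF n z] slope_scale_le [OF n zx] by auto
  define V W where "V = ?v ^ (n + 2)" and "W = ?w ^ (n + 2)"
  have V: "0 < V" and VW: "V \<le> W" using v vw by (simp_all add: V_def W_def power_mono del: power_Suc)
  have W: "0 < W" using V VW by simp
  have kl: "0 < k" "l \<le> k" using k by auto
  have order: "0 < l / W" "l / W \<le> k / W" "l / W \<le> l / V" "k / W \<le> k / V" "l / V \<le> k / V"
    using V W VW k kl by (auto intro: divide_left_mono divide_right_mono)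
  have "k / V < ?E" using kE by (simp only: V_def)
  then have lt: "l / W < ?E" "l / V < ?E" "k / W < ?E" "k / V < ?E" using order by auto
  have "turn_gap n (l / W) * turn_gap n (k / V) \<le> turn_gap n (k / W) * turn_gap n (l / V)"
  proof (rule concave_antimono_product_le [OF concave_turn_gap [OF n] antimono_turn_gap [OF n]])
    show "{l / W..k / V} \<subseteq> {0<..<?E}" using order lt by auto
    show "0 \<le> turn_gap n (k / V)" using turn_gap_pos [OF n, of "k / V"] kl V lt by simp
    show "l / W * (k / V) = k / W * (l / V)" by simp
  qed (use order in auto)
  then have "?v\<^sup>2 * ?w\<^sup>2 * (turn_gap n (l / W) * turn_gap n (k / V))
      \<le> ?v\<^sup>2 * ?w\<^sup>2 * (turn_gap n (k / W) * turn_gap n (l / V))"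
    by (intro mult_left_mono) auto
  moreover have "slope_density n k z = ?v\<^sup>2 * turn_gap n (k / V)" "slope_density n l z = ?v\<^sup>2 * turn_gap n (l / V)"
    "slope_density n k x = ?w\<^sup>2 * turn_gap n (k / W)" "slope_density n l x = ?w\<^sup>2 * turn_gap n (l / W)"
    using z x lt unfolding slope_density_def V_def [symmetric] W_def [symmetric] by simp_all
  ultimately show ?thesis by (simp add: mult_ac)
qed

text \<open>
  For \<open>\<bar>z\<bar> < 1\<close> the slice of slope \<open>z\<close> at level \<open>k\<close> is nonempty iff \<open>slope_scale n z ^ (n + 2)\<close> exceeds \<open>k\<close> divided by
  the depth of the centre. The smaller oval thus misses a whole range of steep slopes that the larger one
  has.
\<close>

lemma slope_density_gap:
  assumes k: "0 < l" "l < k" "k < depth n (centre n)"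
  obtains p q where "p < q" "\<And>z. z \<in> {p<..<q} \<Longrightarrow> slope_density n k z = 0 \<and> 0 < slope_density n l z
      \<and> (\<forall>x. slope_density n k x \<noteq> 0 \<longrightarrow> 1 - z\<^sup>2 < 1 - x\<^sup>2)"
proof -
  let ?E = "depth n (centre n)"
  have E: "0 < ?E" using k by simp
  define a b where "a = root (n + 2) (l / ?E)" and "b = root (n + 2) (k / ?E)"
  have ab: "0 < a" "a < b" "b < 1"
    using k E by (simp_all add: a_def b_def divide_strict_right_mono)
  have pw: "a ^ (n + 2) = l / ?E" "b ^ (n + 2) = k / ?E"
    unfolding a_def b_def using k E by (simp_all only: real_root_pow_pos2 zero_less_Suc add_2_eq_Suc' divide_nonneg_nonneg less_imp_le)
  have abn: "0 < a ^ n" "a ^ n < b ^ n" "b ^ n < 1"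
    using ab n by (auto intro: power_strict_mono simp: power_less_one_iff)
  \<comment> \<open>The slices at the levels \<open>k\<close> and \<open>l\<close> become empty at the slopes \<open>p\<close> and \<open>q\<close>.\<close>
  define p q where "p = sqrt (1 - b ^ n)" and "q = sqrt (1 - a ^ n)"
  show thesis
  proof (rule that)
    show "p < q" using abn by (simp add: p_def q_def)
  next
    fix z assume z: "z \<in> {p<..<q}"
    have "0 \<le> p" using abn by (simp add: p_def)
    have "p\<^sup>2 < z\<^sup>2" "z\<^sup>2 < q\<^sup>2" using z \<open>0 \<le> p\<close> by (auto intro!: power_strict_mono)
    then have z2: "a ^ n < 1 - z\<^sup>2" "1 - z\<^sup>2 < b ^ n" using abn by (auto simp: p_def q_def)
    then have z1: "\<bar>z\<bar> < 1" using abn by (simp flip: abs_square_less_1)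
    let ?w = "slope_scale n z"
    have w: "0 < ?w" "?w ^ n = 1 - z\<^sup>2" using slope_scale_pos [OF n z1] slope_scale_power [OF n] z1 by auto
    have "a < ?w" "?w < b"
      using z2 w ab power_less_imp_less_base [of a n ?w] power_less_imp_less_base [of ?w n b] by auto
    then have "a ^ (n + 2) < ?w ^ (n + 2)" "?w ^ (n + 2) < b ^ (n + 2)"
      using ab w by (auto intro!: power_strict_mono simp del: power_Suc add_2_eq_Suc')
    then have wl: "l / ?w ^ (n + 2) < ?E" and wk: "\<not> k / ?w ^ (n + 2) < ?E" and wk': "?w ^ (n + 2) < k / ?E"
      unfolding pw using w E by (simp_all only: pos_divide_less_eq pos_less_divide_eq zero_less_power mult.commute not_less less_imp_le)
    show "slope_density n k z = 0 \<and> 0 < slope_density n l z \<and> (\<forall>x. slope_density n k x \<noteq> 0 \<longrightarrow> 1 - z\<^sup>2 < 1 - x\<^sup>2)"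
    proof (intro conjI allI impI)
      show "slope_density n k z = 0" unfolding slope_density_def using wk by simp
      have "0 < l / ?w ^ (n + 2)" using k w(1) by simp
      then have "0 < turn_gap n (l / ?w ^ (n + 2))" using turn_gap_pos [OF n] wl by blast
      then show "0 < slope_density n l z" unfolding slope_density_def using wl z1 w by simp
      fix x assume "slope_density n k x \<noteq> 0"
      then have x: "\<bar>x\<bar> < 1" "k / slope_scale n x ^ (n + 2) < ?E"
        unfolding slope_density_def by (auto split: if_splits)
      show "1 - z\<^sup>2 < 1 - x\<^sup>2"
      proof (rule ccontr)
        assume "\<not> 1 - z\<^sup>2 < 1 - x\<^sup>2"
        then have "slope_scale n x \<le> ?w" by (intro slope_scale_le [OF n]) simp
        then have "slope_scale n x ^ (n + 2) \<le> ?w ^ (n + 2)"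
          using slope_scale_pos [OF n x(1)] by (intro power_mono) auto
        then have "k / ?w ^ (n + 2) \<le> k / slope_scale n x ^ (n + 2)"
          using slope_scale_pos [OF n x(1)] k w by (intro divide_left_mono mult_pos_pos zero_less_power) auto
        with x(2) wk show False by linarith
      qed
    qed
  qed
qed

lemma area_moment_ratio_less:
  assumes k: "0 < l" "l < k" "k < depth n (centre n)"
  shows "area_moment n l n * area_moment n k 0 < area_moment n k n * area_moment n l 0"
proof -
  have kk: "0 < k" and lE: "l < depth n (centre n)" using k by auto
  note at_k = area_moment_0_slopes [OF n kk k(3)] area_moment_n_slopes [OF n kk k(3)]
  note at_l = area_moment_0_slopes [OF n k(1) lE] area_moment_n_slopes [OF n k(1) lE]
  obtain p q where pq: "p < q" and gap: "\<And>z. z \<in> {p<..<q} \<Longrightarrow> slope_density n k z = 0 \<and> 0 < slope_density n l z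
      \<and> (\<forall>x. slope_density n k x \<noteq> 0 \<longrightarrow> 1 - z\<^sup>2 < 1 - x\<^sup>2)"
    by (rule slope_density_gap [OF k]) (rule that)
  have "(\<integral>z. (1 - z\<^sup>2) * slope_density n l z \<partial>lborel) * (\<integral>z. slope_density n k z \<partial>lborel)
      < (\<integral>z. (1 - z\<^sup>2) * slope_density n k z \<partial>lborel) * (\<integral>z. slope_density n l z \<partial>lborel)"
  proof (rule monotone_likelihood_ratio_mean_less [where U = "{p<..<q}"])
    show "(\<integral>z. slope_density n k z \<partial>lborel) \<noteq> 0"
      using area_moment_0_pos [OF n kk k(3)] at_k(2) by simp
    show "emeasure lborel {p<..<q} \<noteq> 0" using pq by simp
  qed (use at_k at_l gap slope_density_mlr [OF k] slope_density_nonneg [OF n kk k(3)] in auto)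
  then show ?thesis unfolding at_k(2,4) at_l(2,4) by simp
qed

end

theorem theorem3p6:
  fixes n :: nat
  assumes "0 < n"
  shows "strict_mono_on (energy_range n) (limit_wave_speed n)"
proof (rule strict_mono_onI)
  fix g h assume "g \<in> energy_range n" "h \<in> energy_range n" "g < h"
  then have k: "0 < - h" "- h < - g" "- g < depth n (centre n)" and "0 < - g" "- h < depth n (centre n)"
    by (auto simp: energy_range_iff [OF assms])
  define A where "A = area_moment n (- g)"
  define B where "B = area_moment n (- h)"
  have pos: "0 < A 0" "A 0 < A n" "0 < B 0" "B 0 < B n"
    using area_moment_0_pos [OF assms] area_moment_less [OF assms] \<open>0 < - g\<close> \<open>- h < depth n (centre n)\<close> k
    by (auto simp: A_def B_def)
  have "limit_wave_speed n g = A 0 / (A n - A 0)" "limit_wave_speed n h = B 0 / (B n - B 0)"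
    using limit_wave_speed_moments [OF assms, of "- g"] limit_wave_speed_moments [OF assms, of "- h"]
      \<open>0 < - g\<close> \<open>- h < depth n (centre n)\<close> k
    by (simp_all add: A_def B_def)
  moreover have "B n * A 0 < A n * B 0"
    unfolding A_def B_def by (rule area_moment_ratio_less [OF assms k])
  then have "A 0 * (B n - B 0) < B 0 * (A n - A 0)"
    by (simp add: algebra_simps)
  then have "A 0 / (A n - A 0) < B 0 / (B n - B 0)"
    using pos by (simp add: divide_simps)
  ultimately show "limit_wave_speed n g < limit_wave_speed n h" by simp
qed

end
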